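(* There exists a unital, completely positive, idempotent linear map $\Phi:\ell^\infty(\mathbb Z)\to\ell^\infty(\mathbb Z)$ commuting with the backward shift $B$, whose range is a C*-subalgebra of $\ell^\infty(\mathbb Z)$, such that $\Phi$ is not a homomorphism, $\Phi(c_0(\mathbb Z))=0$, and $\sigma(\Phi)$ is a dense, proper subgroup of $\mathbb T$.
   Context: $(Bv)_n=v_{n+1}$; $c_0(\mathbb Z)$ is the space of null sequences. For $\lambda\in\mathbb T$, $x_\lambda=(\lambda^n)_n$; any linear $\Phi$ commuting with $B$ satisfies $\Phi(x_\lambda)=c_\lambda x_\lambda$ for a scalar $c_\lambda$, and $\sigma(\Phi)=\{\lambda\in\mathbb T:c_\lambda\ne0\}$. *)

theory Defs
  imports "HOL-Analysis.Analysis"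
begin

definition linf :: "(int \<Rightarrow> complex) set" where
  "linf = {x. \<exists>M. \<forall>n. cmod (x n) \<le> M}"

definition supnorm :: "(int \<Rightarrow> complex) \<Rightarrow> real" where
  "supnorm x = (SUP n. cmod (x n))"

definition c0 :: "(int \<Rightarrow> complex) set" where
  "c0 = {x. (x \<longlongrightarrow> 0) at_top \<and> (x \<longlongrightarrow> 0) at_bot}"

definition bshift :: "(int \<Rightarrow> complex) \<Rightarrow> (int \<Rightarrow> complex)" where
  "bshift v = (\<lambda>n. v (n + 1))"

definition psd_mat :: "nat \<Rightarrow> (nat \<Rightarrow> nat \<Rightarrow> complex) \<Rightarrow> bool" where
  "psd_mat n M \<longleftrightarrow> (\<forall>v :: nat \<Rightarrow> complex.
     let q = (\<Sum>i<n. \<Sum>j<n. cnj (v i) * M i j * v j) in Im q = 0 \<and> Re q \<ge> 0)"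

definition is_linear_linf :: "((int \<Rightarrow> complex) \<Rightarrow> (int \<Rightarrow> complex)) \<Rightarrow> bool" where
  "is_linear_linf \<Phi> \<longleftrightarrow> (\<forall>x\<in>linf. \<Phi> x \<in> linf) \<and>
     (\<forall>x\<in>linf. \<forall>y\<in>linf. \<forall>a b :: complex.
        \<Phi> (\<lambda>n. a * x n + b * y n) = (\<lambda>n. a * \<Phi> x n + b * \<Phi> y n))"

text \<open>Complete positivity: for every \<open>n\<close>, the amplification to
  \<open>M\<^sub>n(\<ell>\<^sup>\<infinity>(\<int>)) \<cong> \<ell>\<^sup>\<infinity>(\<int>, M\<^sub>n)\<close> is positive; an element
  \<open>[x\<^sub>i\<^sub>j]\<close> is positive iff the matrix \<open>[x\<^sub>i\<^sub>j(k)]\<close> is PSD for every \<open>k\<close>.\<close>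
definition completely_positive :: "((int \<Rightarrow> complex) \<Rightarrow> (int \<Rightarrow> complex)) \<Rightarrow> bool" where
  "completely_positive \<Phi> \<longleftrightarrow> (\<forall>n X. (\<forall>i<n. \<forall>j<n. X i j \<in> linf) \<and>
      (\<forall>k. psd_mat n (\<lambda>i j. X i j k)) \<longrightarrow> (\<forall>k. psd_mat n (\<lambda>i j. \<Phi> (X i j) k)))"

definition cstar_subalgebra :: "(int \<Rightarrow> complex) set \<Rightarrow> bool" where
  "cstar_subalgebra A \<longleftrightarrow> A \<subseteq> linf \<and> (\<lambda>n. 0) \<in> A \<and>
     (\<forall>x\<in>A. \<forall>y\<in>A. (\<lambda>n. x n + y n) \<in> A \<and> (\<lambda>n. x n * y n) \<in> A) \<and>
     (\<forall>x\<in>A. \<forall>a. (\<lambda>n. a * x n) \<in> A) \<and>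
     (\<forall>x\<in>A. (\<lambda>n. cnj (x n)) \<in> A) \<and>
     (\<forall>f :: nat \<Rightarrow> int \<Rightarrow> complex. \<forall>x\<in>linf. (\<forall>k. f k \<in> A) \<and>
        (\<lambda>k. supnorm (\<lambda>n. f k n - x n)) \<longlonglongrightarrow> 0 \<longrightarrow> x \<in> A)"

definition xchar :: "complex \<Rightarrow> int \<Rightarrow> complex" where
  "xchar l = (\<lambda>n. l powi n)"

definition eigcoef :: "((int \<Rightarrow> complex) \<Rightarrow> (int \<Rightarrow> complex)) \<Rightarrow> complex \<Rightarrow> complex" where
  "eigcoef \<Phi> l = (THE c. \<Phi> (xchar l) = (\<lambda>n. c * xchar l n))"

definition spec :: "((int \<Rightarrow> complex) \<Rightarrow> (int \<Rightarrow> complex)) \<Rightarrow> complex set" where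
  "spec \<Phi> = {l. cmod l = 1 \<and> eigcoef \<Phi> l \<noteq> 0}"

definition subgroup_T :: "complex set \<Rightarrow> bool" where
  "subgroup_T S \<longleftrightarrow> S \<subseteq> sphere 0 1 \<and> 1 \<in> S \<and>
     (\<forall>a\<in>S. \<forall>b\<in>S. a * b \<in> S) \<and> (\<forall>a\<in>S. inverse a \<in> S)"

end

theory Submission
  imports Defs
begin

text \<open>
  A shift-commuting unital positive map on the bounded sequences is \<open>\<Phi> x n = \<phi>(x(\<cdot> + n))\<close> for a mean
  \<open>\<phi>\<close>, and composition of maps is convolution of means. Let \<open>K0\<close> be the means that vanish on \<open>c0\<close>,
  take the value 1 at the characters given by roots of unity and 0 at all other characters: a
  nonempty compact convex semigroup, containing limits of averages over \<open>k! \<int>\<close>. A minimal closed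
  left ideal \<open>L\<close> of \<open>K0\<close> satisfies \<open>\<theta> * \<phi> = \<theta>\<close>, so all its elements are idempotent. \<open>L\<close> is also stable under
  replacing \<open>\<phi>\<close> by \<open>x \<mapsto> \<phi>(w \<Phi> x) / \<phi>(w)\<close> with \<open>w \<ge> 0\<close>; hence an extreme point \<open>\<phi>\<close> of \<open>L\<close> satisfies
  \<open>\<phi>(y \<Phi> x) = \<phi>(y) \<phi>(x)\<close>, which makes the range of \<open>\<Phi>\<close> a subalgebra.
\<close>

section \<open>Means on bounded sequences\<close>

lemma linf_const [simp]: "(\<lambda>n. c) \<in> linf"
  by (auto simp: linf_def)

lemma linfI: "(\<And>n. cmod (x n) \<le> M) \<Longrightarrow> x \<in> linf"
  by (auto simp: linf_def)

lemma linfE: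
  assumes "x \<in> linf"
  obtains M where "M > 0" "\<And>n. cmod (x n) \<le> M"
proof -
  obtain M where "\<And>n. cmod (x n) \<le> M"
    using assms by (auto simp: linf_def)
  then have "max M 1 > 0" "\<And>n. cmod (x n) \<le> max M 1"
    by (auto simp: le_max_iff_disj)
  then show ?thesis by (rule that)
qed

lemma linf_add [simp]: "x \<in> linf \<Longrightarrow> y \<in> linf \<Longrightarrow> (\<lambda>n. x n + y n) \<in> linf"
  by (elim linfE, rule linfI) (rule norm_triangle_mono)

lemma linf_mult [simp]: "x \<in> linf \<Longrightarrow> y \<in> linf \<Longrightarrow> (\<lambda>n. x n * y n) \<in> linf"
proof (elim linfE)
  fix M N assume "M > 0" "\<And>n. cmod (x n) \<le> M" "\<And>n. cmod (y n) \<le> N"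
  then show ?thesis by (intro linfI[of _ "M * N"]) (simp add: norm_mult mult_mono')
qed

lemma linf_minus [simp]: "x \<in> linf \<Longrightarrow> (\<lambda>n. - x n) \<in> linf"
  by (simp add: linf_def)

lemma linf_diff [simp]: "x \<in> linf \<Longrightarrow> y \<in> linf \<Longrightarrow> (\<lambda>n. x n - y n) \<in> linf"
  using linf_add[of x "\<lambda>n. - y n"] by simp

lemma linf_cnj [simp]: "x \<in> linf \<Longrightarrow> (\<lambda>n. cnj (x n)) \<in> linf"
  by (auto simp: linf_def)

lemma linf_comp: "x \<in> linf \<Longrightarrow> (\<lambda>n. x (f n)) \<in> linf"
  by (auto simp: linf_def)

lemma linf_Re [simp]: "x \<in> linf \<Longrightarrow> (\<lambda>n. of_real (Re (x n))) \<in> linf"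
  by (elim linfE, rule linfI) (auto intro: order_trans[OF abs_Re_le_cmod])

lemma linf_Im [simp]: "x \<in> linf \<Longrightarrow> (\<lambda>n. of_real (Im (x n))) \<in> linf"
  by (elim linfE, rule linfI) (auto intro: order_trans[OF abs_Im_le_cmod])

lemma linf_cmod [simp]: "x \<in> linf \<Longrightarrow> (\<lambda>n. of_real (cmod (x n))) \<in> linf"
  by (elim linfE, rule linfI) auto

lemma linf_shift_iff: "(\<lambda>m. x (m + n)) \<in> linf \<longleftrightarrow> x \<in> linf" for n :: int
proof
  assume "(\<lambda>m. x (m + n)) \<in> linf"
  from linf_comp[OF this, of "\<lambda>m. m - n"] show "x \<in> linf" by simp
qed (rule linf_comp)

lemma linf_sum: "(\<And>i. i \<in> I \<Longrightarrow> X i \<in> linf) \<Longrightarrow> (\<lambda>n. \<Sum>i\<in>I. X i n) \<in> linf"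
  by (induction I rule: infinite_finite_induct) auto

lemma xchar_linf [simp]: "cmod l = 1 \<Longrightarrow> xchar l \<in> linf"
  by (auto simp: xchar_def norm_power_int intro!: linfI[of _ 1])

text \<open>Functions are total here. The value 0 off \<open>linf\<close> makes a mean determined by
  its restriction to \<open>linf\<close>, so that equality of functionals is plain equality and the
  set of all means can be compact in the product over all sequences.\<close>

definition mean :: "((int \<Rightarrow> complex) \<Rightarrow> complex) \<Rightarrow> bool" where
  "mean \<phi> \<longleftrightarrow> (\<forall>x. x \<notin> linf \<longrightarrow> \<phi> x = 0) \<and>
     (\<forall>x\<in>linf. \<forall>y\<in>linf. \<forall>a b. \<phi> (\<lambda>n. a * x n + b * y n) = a * \<phi> x + b * \<phi> y) \<and>
     \<phi> (\<lambda>n. 1) = 1 \<and> (\<forall>x\<in>linf. (\<forall>n. x n \<in> \<real>\<^sub>\<ge>\<^sub>0) \<longrightarrow> \<phi> x \<in> \<real>\<^sub>\<ge>\<^sub>0)"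

section \<open>Order and norm properties of a single mean\<close>

context
  fixes \<phi> assumes mean: "mean \<phi>"
begin

lemma mean_out: "x \<notin> linf \<Longrightarrow> \<phi> x = 0"
  using mean by (simp add: mean_def)

lemma mean_lin: "x \<in> linf \<Longrightarrow> y \<in> linf \<Longrightarrow> \<phi> (\<lambda>n. a * x n + b * y n) = a * \<phi> x + b * \<phi> y"
  using mean by (simp add: mean_def)

lemma mean_one: "\<phi> (\<lambda>n. 1) = 1"
  using mean by (simp add: mean_def)

lemma mean_pos: "x \<in> linf \<Longrightarrow> (\<And>n. x n \<in> \<real>\<^sub>\<ge>\<^sub>0) \<Longrightarrow> \<phi> x \<in> \<real>\<^sub>\<ge>\<^sub>0"
  using mean by (simp add: mean_def)

lemma mean_add: "x \<in> linf \<Longrightarrow> y \<in> linf \<Longrightarrow> \<phi> (\<lambda>n. x n + y n) = \<phi> x + \<phi> y"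
  using mean_lin[of x y 1 1] by simp

lemma mean_diff: "x \<in> linf \<Longrightarrow> y \<in> linf \<Longrightarrow> \<phi> (\<lambda>n. x n - y n) = \<phi> x - \<phi> y"
  using mean_lin[of x y 1 "-1"] by simp

lemma mean_scale: "x \<in> linf \<Longrightarrow> \<phi> (\<lambda>n. a * x n) = a * \<phi> x"
  using mean_lin[of x x a 0] by simp

lemma mean_const: "\<phi> (\<lambda>n. c) = c"
  using mean_scale[of "\<lambda>n. 1" c] mean_one by simp

lemma mean_sum: "(\<And>i. i \<in> I \<Longrightarrow> X i \<in> linf) \<Longrightarrow> \<phi> (\<lambda>n. \<Sum>i\<in>I. X i n) = (\<Sum>i\<in>I. \<phi> (X i))"
  by (induction I rule: infinite_finite_induct) (auto simp: mean_const mean_add linf_sum)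

lemma mean_mono:
  assumes "(\<lambda>n. of_real (u n)) \<in> linf" "(\<lambda>n. of_real (v n)) \<in> linf" "\<And>n. u n \<le> v n"
  shows "Re (\<phi> (\<lambda>n. of_real (u n))) \<le> Re (\<phi> (\<lambda>n. of_real (v n)))"
proof -
  have "\<phi> (\<lambda>n. of_real (v n) - of_real (u n)) \<in> \<real>\<^sub>\<ge>\<^sub>0"
    using assms by (intro mean_pos) (auto simp: complex_nonneg_Reals_iff)
  then show ?thesis
    using assms by (simp add: mean_diff complex_nonneg_Reals_iff)
qed

text \<open>Adding the bound \<open>M\<close> makes the sequence nonnegative, and the mean of the
  constant \<open>M\<close> is the real number \<open>M\<close>.\<close>

lemma mean_real:
  assumes "(\<lambda>n. of_real (u n)) \<in> linf"
  shows "Im (\<phi> (\<lambda>n. of_real (u n))) = 0"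
proof -
  obtain M where M: "M > 0" "\<And>n. cmod (of_real (u n)) \<le> M"
    using assms by (rule linfE) blast
  have "u n + M \<ge> 0" for n
    using M(2)[of n] by (simp add: abs_le_iff)
  then have "\<phi> (\<lambda>n. of_real (u n) + of_real M) \<in> \<real>\<^sub>\<ge>\<^sub>0"
    using assms by (intro mean_pos) (auto simp: complex_nonneg_Reals_iff)
  then show ?thesis
    using assms by (simp add: mean_add mean_const complex_nonneg_Reals_iff)
qed

lemma mean_Re_Im:
  assumes "x \<in> linf"
  shows "\<phi> x = \<phi> (\<lambda>n. of_real (Re (x n))) + \<i> * \<phi> (\<lambda>n. of_real (Im (x n)))"
proof -
  have "\<phi> (\<lambda>n. 1 * of_real (Re (x n)) + \<i> * of_real (Im (x n))) =
      1 * \<phi> (\<lambda>n. of_real (Re (x n))) + \<i> * \<phi> (\<lambda>n. of_real (Im (x n)))"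
    using assms by (intro mean_lin) auto
  then show ?thesis by (simp flip: complex_eq)
qed

lemma mean_cnj:
  assumes "x \<in> linf"
  shows "\<phi> (\<lambda>n. cnj (x n)) = cnj (\<phi> x)"
proof -
  have "\<phi> (\<lambda>n. cnj (x n)) = \<phi> (\<lambda>n. of_real (Re (x n))) - \<i> * \<phi> (\<lambda>n. of_real (Im (x n)))"
    using mean_Re_Im[of "\<lambda>n. cnj (x n)"] assms mean_scale[of "\<lambda>n. of_real (Im (x n))" "-1"]
    by simp
  then show ?thesis
    using assms mean_real[of "\<lambda>n. Re (x n)"] mean_real[of "\<lambda>n. Im (x n)"]
    by (simp add: mean_Re_Im[of x] complex_eq_iff)
qed

text \<open>A unimodular \<open>c\<close> rotates \<open>\<phi> x\<close> onto the nonnegative axis.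
  Then only the real part of \<open>c * x n\<close> counts, and it is at most
  \<open>cmod (x n)\<close>.\<close>

lemma mean_abs:
  assumes "x \<in> linf"
  shows "cmod (\<phi> x) \<le> Re (\<phi> (\<lambda>n. of_real (cmod (x n))))"
proof -
  obtain c where c: "cmod c = 1" "c * \<phi> x = of_real (cmod (\<phi> x))"
  proof (cases "\<phi> x = 0")
    case False
    then have "cmod (cnj (\<phi> x) / of_real (cmod (\<phi> x))) = 1"
      "cnj (\<phi> x) / of_real (cmod (\<phi> x)) * \<phi> x = of_real (cmod (\<phi> x))"
      by (simp_all add: norm_divide field_simps complex_norm_square[symmetric] power2_eq_square)
    then show ?thesis by (rule that)
  qed (auto intro: that[of 1])
  have cx: "(\<lambda>n. c * x n) \<in> linf" using assms by simp
  have "of_real (cmod (\<phi> x)) = \<phi> (\<lambda>n. c * x n)"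
    using c assms by (simp add: mean_scale)
  then have "cmod (\<phi> x) = Re (\<phi> (\<lambda>n. c * x n))"
    by (metis Re_complex_of_real)
  also have "\<dots> = Re (\<phi> (\<lambda>n. of_real (Re (c * x n))))"
    using mean_Re_Im[OF cx] mean_real[OF linf_Im[OF cx]] by simp
  also have "\<dots> \<le> Re (\<phi> (\<lambda>n. of_real (cmod (x n))))"
  proof (rule mean_mono)
    show "Re (c * x n) \<le> cmod (x n)" for n
      using complex_Re_le_cmod[of "c * x n"] c(1) by (simp add: norm_mult)
  qed (use assms linf_Re[OF cx] in auto)
  finally show ?thesis .
qed

lemma mean_bound:
  assumes "\<And>n. cmod (x n) \<le> M"
  shows "cmod (\<phi> x) \<le> M"
proof -
  have x: "x \<in> linf" using assms by (rule linfI)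
  have "cmod (\<phi> x) \<le> Re (\<phi> (\<lambda>n. of_real (cmod (x n))))"
    by (rule mean_abs[OF x])
  also have "\<dots> \<le> Re (\<phi> (\<lambda>n. of_real M))"
    using x assms by (intro mean_mono) auto
  finally show ?thesis by (simp add: mean_const)
qed

end

section \<open>Compactness\<close>

text \<open>The function type carries the product topology, which on means is the weak-* topology:
  evaluations are coordinate projections.\<close>

lemma continuous_on_eval: "continuous_on S (\<lambda>\<phi>. \<phi> x :: 'b::topological_space)"
  by (rule continuous_on_subset[OF continuous_on_product_coordinates[of x] subset_UNIV])

lemma closed_eval_eq: "closed {\<phi>. \<phi> x = (c :: 'b::t2_space)}"
  by (rule closed_Collect_eq[OF continuous_on_eval[of UNIV x] continuous_on_const[of UNIV c]])

lemma closed_mean: "closed (Collect mean)"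
proof -
  have "Collect mean = (\<Inter>x\<in>-linf. {\<phi>. \<phi> x = 0}) \<inter>
    (\<Inter>x\<in>linf. \<Inter>y\<in>linf. \<Inter>a. \<Inter>b. {\<phi>. \<phi> (\<lambda>n. a * x n + b * y n) = a * \<phi> x + b * \<phi> y}) \<inter>
    {\<phi>. \<phi> (\<lambda>n. 1) = 1} \<inter> (\<Inter>x\<in>{x\<in>linf. \<forall>n. x n \<in> \<real>\<^sub>\<ge>\<^sub>0}. (\<lambda>\<phi>. \<phi> x) -` \<real>\<^sub>\<ge>\<^sub>0)"
    by (auto simp: mean_def)
  also have "closed \<dots>"
  proof (intro closed_Int closed_INT ballI closed_eval_eq)
    fix x y :: "int \<Rightarrow> complex" and a b :: complex
    have "continuous_on UNIV (\<lambda>\<phi>. a * \<phi> x + b * \<phi> y)"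
      by (intro continuous_on_add continuous_on_mult_left continuous_on_eval[of _ x] continuous_on_eval[of _ y])
    then show "closed {\<phi>. \<phi> (\<lambda>n. a * x n + b * y n) = a * \<phi> x + b * \<phi> y}"
      by (rule closed_Collect_eq[OF continuous_on_eval[of UNIV "\<lambda>n. a * x n + b * y n"]])
  next
    fix x :: "int \<Rightarrow> complex"
    show "closed ((\<lambda>\<phi>. \<phi> x) -` (\<real>\<^sub>\<ge>\<^sub>0 :: complex set))"
      by (rule closed_vimage[OF closed_nonneg_Reals_complex continuous_on_eval])
  qed
  finally show ?thesis .
qed

text \<open>Banach-Alaoglu through Tychonoff: the norm bound puts every mean into a product of
  closed discs, with the singleton of 0 at each unbounded sequence.\<close>

lemma compact_mean: "compact (Collect mean)"
proof -
  define B where "B x = (if x \<in> linf then cball 0 (SUP n. cmod (x n)) else {0 :: complex})"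
    for x :: "int \<Rightarrow> complex"
  have "compact (Pi\<^sub>E UNIV B)"
  proof -
    have "compactin (product_topology (\<lambda>i. euclidean) UNIV) (Pi\<^sub>E UNIV B)"
      by (subst compactin_PiE) (auto simp: B_def)
    then show ?thesis by (simp add: euclidean_product_topology)
  qed
  moreover have "Collect mean \<subseteq> Pi\<^sub>E UNIV B"
  proof (safe, simp_all add: PiE_UNIV_domain)
    fix \<phi> x assume \<phi>: "mean \<phi>"
    show "\<phi> x \<in> B x"
    proof (cases "x \<in> linf")
      case True
      then obtain M where "\<And>n. cmod (x n) \<le> M" by (auto simp: linf_def)
      then have "cmod (x n) \<le> (SUP n. cmod (x n))" for n
        by (intro cSUP_upper bdd_aboveI2[of _ _ M]) auto
      then show ?thesis
        using mean_bound[OF \<phi>] True by (simp add: B_def)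
    qed (simp add: B_def mean_out[OF \<phi>])
  qed
  ultimately show ?thesis
    using closed_mean by (metis compact_Int_closed inf.absorb_iff2)
qed

text \<open>A cluster point stands in for a convergent subsequence, which compactness of an
  uncountable product does not provide. Each coordinate that converges along the sequence passes its
  limit to the cluster point.\<close>

lemma compact_cluster:
  fixes f :: "nat \<Rightarrow> 'a \<Rightarrow> 'b::t2_space"
  assumes "compact K" "\<And>k. f k \<in> K"
  shows "\<exists>\<phi>\<in>K. \<forall>x c. (\<lambda>k. f k x) \<longlonglongrightarrow> c \<longrightarrow> \<phi> x = c"
proof -
  have "filtermap f sequentially \<noteq> bot"
    by (simp add: filtermap_bot_iff)
  moreover have "eventually (\<lambda>x. x \<in> K) (filtermap f sequentially)"
    using assms(2) by (simp add: eventually_filtermap)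
  ultimately obtain \<phi> where \<phi>: "\<phi> \<in> K" "inf (nhds \<phi>) (filtermap f sequentially) \<noteq> bot"
    using assms(1) unfolding compact_filter by blast
  have "\<phi> x = c" if "(\<lambda>k. f k x) \<longlonglongrightarrow> c" for x c
  proof (rule tendsto_unique[OF \<phi>(2)])
    have "((\<lambda>\<psi>. \<psi> x) \<longlongrightarrow> \<phi> x) (nhds \<phi>)"
    proof (rule topological_tendstoI)
      fix S assume "open S" "\<phi> x \<in> S"
      then have "open ((\<lambda>\<psi>. \<psi> x) -` S)" "\<phi> \<in> (\<lambda>\<psi>. \<psi> x) -` S"
        by (auto intro!: open_vimage continuous_on_eval)
      then show "\<forall>\<^sub>F \<psi> in nhds \<phi>. \<psi> x \<in> S"
        unfolding eventually_nhds by blast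
    qed
    then show "((\<lambda>\<psi>. \<psi> x) \<longlongrightarrow> \<phi> x) (inf (nhds \<phi>) (filtermap f sequentially))"
      by (rule tendsto_mono[rotated]) simp
    have "((\<lambda>\<psi>. \<psi> x) \<longlongrightarrow> c) (filtermap f sequentially)"
      using that by (simp add: filterlim_filtermap)
    then show "((\<lambda>\<psi>. \<psi> x) \<longlongrightarrow> c) (inf (nhds \<phi>) (filtermap f sequentially))"
      by (rule tendsto_mono[rotated]) simp
  qed
  with \<phi>(1) show ?thesis by blast
qed

text \<open>Zorn's lemma, where compactness keeps the intersection of a chain nonempty. It serves
  twice: for a minimal closed left ideal and for a minimal closed face.\<close>

lemma minimal_closed_set:
  assumes "compact K" and P: "P K" "\<And>C. C \<noteq> {} \<Longrightarrow> (\<And>A. A \<in> C \<Longrightarrow> P A) \<Longrightarrow> P (\<Inter>C)"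
    and closed: "\<And>A. P A \<Longrightarrow> closed A" and "K \<noteq> {}"
  obtains A where "P A" "A \<noteq> {}" "A \<subseteq> K" "\<And>B. P B \<Longrightarrow> B \<noteq> {} \<Longrightarrow> B \<subseteq> A \<Longrightarrow> B = A"
proof -
  define S where "S = {A. P A \<and> A \<noteq> {} \<and> A \<subseteq> K}"
  \<comment> \<open>Passing to complements turns the maximal element of \<open>subset_Zorn\<close>
    into a minimal set.\<close>
  have "\<exists>U\<in>uminus ` S. \<forall>X\<in>C. X \<subseteq> U" if C: "subset.chain (uminus ` S) C" for C
  proof (cases "C = {}")
    case True
    then show ?thesis using P(1) \<open>K \<noteq> {}\<close> by (auto simp: S_def)
  next
    case False
    define D where "D = uminus ` C"
    have D: "D \<noteq> {}" "D \<subseteq> S" 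
      using False C by (auto simp: D_def subset.chain_def)
    have chain: "A \<subseteq> B \<or> B \<subseteq> A" if "A \<in> D" "B \<in> D" for A B
    proof -
      have "- A \<in> C" "- B \<in> C" using that by (auto simp: D_def)
      then have "- A \<subseteq> - B \<or> - B \<subseteq> - A"
        using C unfolding subset.chain_def by blast
      then show ?thesis by blast
    qed
    have "K \<inter> \<Inter>D \<noteq> {}"
    proof (rule compact_imp_fip[OF \<open>compact K\<close>])
      show "closed A" if "A \<in> D" for A using that D closed by (auto simp: S_def)
      fix F assume F: "finite F" "F \<subseteq> D"
      show "K \<inter> \<Inter>F \<noteq> {}"
      proof (cases "F = {}")
        case False
        \<comment> \<open>A finite nonempty chain contains its own intersection, which is therefore
          nonempty.\<close>
        have "\<Inter>F \<in> F"
          using F(1) False F(2)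
        proof (induction F rule: finite_ne_induct)
          case (insert A F)
          then have "A \<subseteq> \<Inter>F \<or> \<Inter>F \<subseteq> A" using chain by blast
          then have "A \<inter> \<Inter>F = A \<or> A \<inter> \<Inter>F = \<Inter>F" by blast
          then show ?case using insert by auto
        qed auto
        then have "\<Inter>F \<in> S" using F(2) D(2) by blast
        then show ?thesis unfolding S_def by blast
      qed (use \<open>K \<noteq> {}\<close> in auto)
    qed
    then have "\<Inter>D \<in> S"
      using D P(2)[of D] by (auto simp: S_def)
    moreover have "X \<subseteq> - \<Inter>D" if "X \<in> C" for X
      using that by (auto simp: D_def)
    ultimately show ?thesis by blast
  qed
  then obtain M where M: "M \<in> uminus ` S" "\<And>X. X \<in> uminus ` S \<Longrightarrow> M \<subseteq> X \<Longrightarrow> X = M"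
    using subset_Zorn[of "uminus ` S"] by metis
  then obtain A where A: "A \<in> S" "M = - A" by blast
  show ?thesis
  proof (rule that[of A])
    fix B assume "P B" "B \<noteq> {}" "B \<subseteq> A"
    then have "B \<in> S" using A by (auto simp: S_def)
    then show "B = A" using M(2)[of "- B"] A \<open>B \<subseteq> A\<close> by auto
  qed (use A in \<open>auto simp: S_def\<close>)
qed

section \<open>A mean built from windows that move to infinity\<close>

lemma mean_point: "mean (\<lambda>x. if x \<in> linf then x j else 0)"
  by (simp add: mean_def)

lemma mean_average:
  assumes "\<And>k. mean (f k)" "n > 0"
  shows "mean (\<lambda>x. (\<Sum>k<n. f k x) / of_nat n)"
  unfolding mean_def
proof (intro conjI ballI allI impI)
  fix x y :: "int \<Rightarrow> complex" and a b :: complex assume "x \<in> linf" "y \<in> linf"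
  then show "(\<Sum>k<n. f k (\<lambda>n. a * x n + b * y n)) / of_nat n =
      a * ((\<Sum>k<n. f k x) / of_nat n) + b * ((\<Sum>k<n. f k y) / of_nat n)"
    by (simp add: mean_lin[OF assms(1)] sum.distrib add_divide_distrib flip: sum_distrib_left)
next
  fix x :: "int \<Rightarrow> complex" assume "x \<in> linf" "\<forall>n. x n \<in> \<real>\<^sub>\<ge>\<^sub>0"
  then have "f k x \<in> \<real>\<^sub>\<ge>\<^sub>0" for k
    by (intro mean_pos[OF assms(1)]) auto
  then show "(\<Sum>k<n. f k x) / of_nat n \<in> \<real>\<^sub>\<ge>\<^sub>0"
    by (simp add: complex_nonneg_Reals_iff sum_nonneg)
qed (use assms in \<open>simp_all add: mean_out mean_one\<close>)

text \<open>Averaging over the windows \<open>[N, 2N)\<close> rather than \<open>[0, N)\<close> makes the averages of a null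
  sequence tend to \<open>0\<close> without a Cesaro argument.\<close>
lemma window_mean:
  obtains M where "mean M"
    and "\<And>\<mu>. cmod \<mu> = 1 \<Longrightarrow> M (xchar \<mu>) = (if \<mu> = 1 then 1 else 0)"
    and "\<And>x. (x \<longlongrightarrow> 0) at_top \<Longrightarrow> M x = 0"
proof -
  \<comment> \<open>\<open>Suc N\<close> is both the start and the length of the window: the divisor
    is nonzero and every position in the window tends to infinity with \<open>N\<close>.\<close>
  define f where "f N x = (\<Sum>k<Suc N. if x \<in> linf then x (int (Suc N + k)) else 0) / of_nat (Suc N)"
    for N and x :: "int \<Rightarrow> complex"
  have f_mean: "f N \<in> Collect mean" for N
    using mean_average[OF mean_point, of "Suc N" "\<lambda>k. int (Suc N + k)"]
    by (simp add: f_def[abs_def])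
  have "\<exists>M\<in>Collect mean. \<forall>x c. (\<lambda>N. f N x) \<longlonglongrightarrow> c \<longrightarrow> M x = c"
    by (rule compact_cluster[OF compact_mean]) (rule f_mean)
  then obtain M where "M \<in> Collect mean" "\<forall>x c. (\<lambda>N. f N x) \<longlonglongrightarrow> c \<longrightarrow> M x = c"
    by (rule bexE)
  then have M: "mean M" "\<And>x c. (\<lambda>N. f N x) \<longlonglongrightarrow> c \<Longrightarrow> M x = c"
    by simp_all
  show ?thesis
  proof (rule that[of M])
    fix \<mu> :: complex assume \<mu>: "cmod \<mu> = 1"
    show "M (xchar \<mu>) = (if \<mu> = 1 then 1 else 0)"
    proof (cases "\<mu> = 1")
      case True
      then show ?thesis using mean_one[OF M(1)] by (simp add: xchar_def)
    next
      case False
      \<comment> \<open>For \<mu> \<noteq> 1 the window sum is geometric, hence bounded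
        independently of \<open>N\<close>, and the division by \<open>Suc N\<close> sends it to
        0.\<close>
      have f: "f N (xchar \<mu>) = \<mu> ^ Suc N * ((\<mu> ^ Suc N - 1) / (\<mu> - 1)) / of_nat (Suc N)" for N
      proof -
        have "xchar \<mu> (int (Suc N + k)) = \<mu> ^ Suc N * \<mu> ^ k" for k
          unfolding xchar_def power_int_of_nat by (rule power_add)
        then have "f N (xchar \<mu>) = (\<Sum>k<Suc N. \<mu> ^ Suc N * \<mu> ^ k) / of_nat (Suc N)"
          using \<mu> unfolding f_def by (simp only: xchar_linf if_True)
        also have "(\<Sum>k<Suc N. \<mu> ^ Suc N * \<mu> ^ k) = \<mu> ^ Suc N * (\<Sum>k<Suc N. \<mu> ^ k)"
          by (rule sum_distrib_left[symmetric])
        also have "(\<Sum>k<Suc N. \<mu> ^ k) = (\<mu> ^ Suc N - 1) / (\<mu> - 1)"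
          by (rule geometric_sum[OF False])
        finally show ?thesis .
      qed
      have "cmod (f N (xchar \<mu>)) \<le> 2 / cmod (\<mu> - 1) * inverse (real (Suc N))" for N
      proof -
        have "cmod (\<mu> ^ Suc N - 1) \<le> 2"
          using norm_triangle_ineq4[of "\<mu> ^ Suc N" 1] \<mu> by (simp only: norm_power norm_one power_one)
        then have "cmod (\<mu> ^ Suc N - 1) / cmod (\<mu> - 1) / real (Suc N) \<le> 2 / cmod (\<mu> - 1) / real (Suc N)"
          by (intro divide_right_mono) auto
        then show ?thesis
          unfolding f norm_mult norm_divide norm_power \<mu> norm_of_nat
          by (simp only: power_one mult_1 divide_inverse)
      qed
      then have "\<forall>\<^sub>F N in sequentially.
          cmod (f N (xchar \<mu>)) \<le> 2 / cmod (\<mu> - 1) * inverse (real (Suc N))"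
        by (rule always_eventually[OF allI])
      from Lim_null_comparison[OF this tendsto_mult_right_zero[OF LIMSEQ_inverse_real_of_nat]]
      have "(\<lambda>N. f N (xchar \<mu>)) \<longlonglongrightarrow> 0" .
      then show ?thesis using False M(2) by simp
    qed
  next
    fix x :: "int \<Rightarrow> complex" assume x: "(x \<longlongrightarrow> 0) at_top"
    have "(\<lambda>N. f N x) \<longlonglongrightarrow> 0"
    proof (rule LIMSEQ_I)
      fix r :: real assume r: "r > 0"
      from x have "eventually (\<lambda>n. cmod (x n) < r / 2) at_top"
        using r by (auto simp: tendsto_iff dest: spec[of _ "r / 2"])
      then obtain n0 where n0: "\<And>n. n \<ge> n0 \<Longrightarrow> cmod (x n) < r / 2"
        by (auto simp: eventually_at_top_linorder)
      have "cmod (f N x - 0) < r" if "N \<ge> nat n0" for N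
      proof -
        have "cmod (\<Sum>k<Suc N. if x \<in> linf then x (int (Suc N + k)) else 0) \<le> of_nat (card {..<Suc N}) * (r / 2)"
        proof (rule sum_norm_bound)
          fix k
          have "int (Suc N + k) \<ge> n0" using that by linarith
          from n0[OF this] show "cmod (if x \<in> linf then x (int (Suc N + k)) else 0) \<le> r / 2"
            using r by simp
        qed
        then have "cmod (f N x) \<le> r / 2"
          unfolding f_def norm_divide norm_of_nat by (simp only: card_lessThan) (simp add: field_simps)
        then show ?thesis using r by simp
      qed
      then show "\<exists>N0. \<forall>N\<ge>N0. cmod (f N x - 0) < r" by blast
    qed
    then show "M x = 0" by (rule M(2))
  qed (rule M(1))
qed

section \<open>Means with spectrum the roots of unity\<close>

definition roots_of_unity :: "complex set" where
  "roots_of_unity = {l. \<exists>k>0. l ^ k = 1}"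

text \<open>The spectrum is fixed in advance. All conditions are closed, and they survive
  convolution, averaging and tilting, so the whole construction stays inside this set.\<close>

definition K0 :: "((int \<Rightarrow> complex) \<Rightarrow> complex) set" where
  "K0 = {\<phi>. mean \<phi> \<and> (\<forall>x\<in>c0. \<phi> x = 0) \<and>
     (\<forall>l. cmod l = 1 \<longrightarrow> \<phi> (xchar l) = (if l \<in> roots_of_unity then 1 else 0))}"

lemma K0_mean: "\<phi> \<in> K0 \<Longrightarrow> mean \<phi>"
  and K0_c0: "\<phi> \<in> K0 \<Longrightarrow> x \<in> c0 \<Longrightarrow> \<phi> x = 0"
  and K0_xchar: "\<phi> \<in> K0 \<Longrightarrow> cmod l = 1 \<Longrightarrow> \<phi> (xchar l) = (if l \<in> roots_of_unity then 1 else 0)"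
  by (auto simp: K0_def)

lemma closed_K0: "closed K0"
proof -
  have "K0 = Collect mean \<inter> (\<Inter>x\<in>c0. {\<phi>. \<phi> x = 0}) \<inter>
    (\<Inter>l\<in>{l. cmod l = 1}. {\<phi>. \<phi> (xchar l) = (if l \<in> roots_of_unity then 1 else 0)})"
    by (auto simp: K0_def)
  also have "closed \<dots>"
    by (intro closed_Int closed_INT ballI closed_eval_eq closed_mean)
  finally show ?thesis .
qed

lemma compact_K0: "compact K0"
proof -
  have "compact (Collect mean \<inter> K0)"
    by (rule compact_Int_closed[OF compact_mean closed_K0])
  also have "Collect mean \<inter> K0 = K0"
    by (auto simp: K0_def)
  finally show ?thesis .
qed

text \<open>Sampling along the multiples of \<open>fact k\<close> turns \<open>xchar l\<close> into
  \<open>xchar (l ^ fact k)\<close>, on which \<open>M\<close> is 1 or 0 according to whether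
  \<open>l ^ fact k = 1\<close>. For a root of unity this equation holds for all large
  \<open>k\<close>, for any other \<open>l\<close> never; a cluster point has the limiting
  values.\<close>

lemma K0_nonempty: "K0 \<noteq> {}"
proof -
  obtain M where M: "mean M"
    "\<And>\<mu>. cmod \<mu> = 1 \<Longrightarrow> M (xchar \<mu>) = (if \<mu> = 1 then 1 else 0)"
    "\<And>x. (x \<longlongrightarrow> 0) at_top \<Longrightarrow> M x = 0"
    by (rule window_mean) blast
  define f where "f k x = (if x \<in> linf then M (\<lambda>j. x (fact k * j)) else 0)"
    for k :: nat and x :: "int \<Rightarrow> complex"
  have f_mean: "f k \<in> Collect mean" for k
  proof -
    have c: "x \<in> linf \<Longrightarrow> (\<lambda>j. x (fact k * j)) \<in> linf" for x :: "int \<Rightarrow> complex"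
      by (rule linf_comp)
    have "f k (\<lambda>n. a * x n + b * y n) = a * f k x + b * f k y"
      if "x \<in> linf" "y \<in> linf" for x y a b
      using mean_lin[OF M(1) c[OF that(1)] c[OF that(2)]] that by (simp add: f_def)
    moreover have "f k x \<in> \<real>\<^sub>\<ge>\<^sub>0" if "x \<in> linf" "\<forall>n. x n \<in> \<real>\<^sub>\<ge>\<^sub>0" for x
      using mean_pos[OF M(1) c[OF that(1)]] that by (simp add: f_def)
    ultimately show ?thesis
      using mean_one[OF M(1)] by (simp add: mean_def f_def)
  qed
  have "\<exists>\<phi>\<in>Collect mean. \<forall>x c. (\<lambda>k. f k x) \<longlonglongrightarrow> c \<longrightarrow> \<phi> x = c"
    by (rule compact_cluster[OF compact_mean]) (rule f_mean)
  then obtain \<phi> where "\<phi> \<in> Collect mean" "\<forall>x c. (\<lambda>k. f k x) \<longlonglongrightarrow> c \<longrightarrow> \<phi> x = c"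
    by (rule bexE)
  then have \<phi>: "mean \<phi>" "\<And>x c. (\<lambda>k. f k x) \<longlonglongrightarrow> c \<Longrightarrow> \<phi> x = c"
    by simp_all
  have "\<phi> x = 0" if "x \<in> c0" for x
  proof (rule \<phi>(2))
    have "((\<lambda>j. x (fact k * j)) \<longlongrightarrow> 0) at_top" for k
    proof (rule filterlim_compose[of x])
      show "filterlim (\<lambda>j. fact k * j :: int) at_top at_top"
      proof (rule filterlim_at_top_mono[OF filterlim_ident])
        have "j \<le> fact k * j" if "j \<ge> 0" for j :: int
          using mult_right_mono[of 1 "fact k" j] that by (simp add: fact_ge_1)
        then show "\<forall>\<^sub>F j in at_top. j \<le> (fact k * j :: int)"
          by (auto simp: eventually_at_top_linorder)
      qed
    qed (use that in \<open>simp add: c0_def\<close>)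
    then have "f k x = 0" for k
      unfolding f_def using M(3) by presburger
    then show "(\<lambda>k. f k x) \<longlonglongrightarrow> 0" by simp
  qed
  moreover have "\<phi> (xchar l) = (if l \<in> roots_of_unity then 1 else 0)" if l: "cmod l = 1" for l
  proof (rule \<phi>(2))
    have f: "f k (xchar l) = (if l ^ fact k = 1 then 1 else 0)" for k
    proof -
      have "(\<lambda>j. xchar l (fact k * j)) = xchar (l ^ fact k)"
        by (auto simp: xchar_def power_int_mult simp flip: power_int_of_nat)
      then show ?thesis
        using l M(2)[of "l ^ fact k"] by (simp add: f_def norm_power)
    qed
    show "(\<lambda>k. f k (xchar l)) \<longlonglongrightarrow> (if l \<in> roots_of_unity then 1 else 0)"
    proof (cases "l \<in> roots_of_unity")
      case True
      then obtain n where n: "n > 0" "l ^ n = 1" by (auto simp: roots_of_unity_def)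
      have "f k (xchar l) = 1" if "k \<ge> n" for k
      proof -
        have "n dvd fact k" using n that by (intro dvd_fact) auto
        then have "l ^ fact k = 1" using n by (auto simp: dvd_def power_mult)
        then show ?thesis by (simp add: f)
      qed
      then show ?thesis
        using True by (auto intro!: tendsto_eventually eventually_sequentiallyI[of n])
    next
      case False
      then have "l ^ fact k \<noteq> 1" for k
        by (auto simp: roots_of_unity_def dest: spec[of _ "fact k"])
      then show ?thesis using False by (simp add: f)
    qed
  qed
  ultimately have "\<phi> \<in> K0" using \<phi>(1) by (simp add: K0_def)
  then show ?thesis by blast
qed

section \<open>Shift-commuting maps and convolution\<close>

text \<open>A shift-commuting map is determined by its coordinate at 0; this formula rebuilds the
  map from that functional.\<close>

definition orbit_map :: "((int \<Rightarrow> complex) \<Rightarrow> complex) \<Rightarrow> (int \<Rightarrow> complex) \<Rightarrow> int \<Rightarrow> complex" where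
  "orbit_map \<phi> x = (\<lambda>n. \<phi> (\<lambda>m. x (m + n)))"

text \<open>The product of functionals that corresponds to composition of maps. It is continuous in
  the left factor, since its value at \<open>x\<close> is \<phi> at a sequence depending only on
  \<psi> and \<open>x\<close>.\<close>

definition conv :: "((int \<Rightarrow> complex) \<Rightarrow> complex) \<Rightarrow> ((int \<Rightarrow> complex) \<Rightarrow> complex) \<Rightarrow>
    (int \<Rightarrow> complex) \<Rightarrow> complex" where
  "conv \<phi> \<psi> = (\<lambda>x. \<phi> (orbit_map \<psi> x))"

lemma orbit_map_shift: "orbit_map \<phi> (\<lambda>m. x (m + n)) = (\<lambda>m. orbit_map \<phi> x (m + n))"
  by (simp add: orbit_map_def add.assoc)

text \<open>Through this identity an idempotent functional gives an idempotent map.\<close>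

lemma orbit_map_conv: "orbit_map (conv \<phi> \<psi>) x = orbit_map \<phi> (orbit_map \<psi> x)"
  by (simp add: orbit_map_def conv_def add.assoc)

lemma conv_assoc: "conv (conv \<phi> \<psi>) \<theta> = conv \<phi> (conv \<psi> \<theta>)"
  unfolding conv_def[of \<phi> "conv \<psi> \<theta>"] orbit_map_conv by (simp add: conv_def)

section \<open>Action of the maps on bounded sequences, null sequences and characters\<close>

lemma orbit_map_out:
  assumes "mean \<phi>" "x \<notin> linf"
  shows "orbit_map \<phi> x = (\<lambda>n. 0)"
  using assms by (auto simp: orbit_map_def mean_out linf_shift_iff)

lemma orbit_map_bound:
  assumes "mean \<phi>" "\<And>n. cmod (x n) \<le> M"
  shows "cmod (orbit_map \<phi> x n) \<le> M"
  unfolding orbit_map_def by (rule mean_bound[OF assms(1)]) (rule assms(2))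

lemma orbit_map_linf:
  assumes "mean \<phi>"
  shows "orbit_map \<phi> x \<in> linf"
proof (cases "x \<in> linf")
  case True
  then show ?thesis
    by (elim linfE) (rule linfI, rule orbit_map_bound[OF assms])
qed (use assms in \<open>simp add: orbit_map_out\<close>)

lemma orbit_map_lin:
  assumes "mean \<phi>" "x \<in> linf" "y \<in> linf"
  shows "orbit_map \<phi> (\<lambda>n. a * x n + b * y n) = (\<lambda>n. a * orbit_map \<phi> x n + b * orbit_map \<phi> y n)"
  using mean_lin[OF assms(1) linf_comp[OF assms(2)] linf_comp[OF assms(3)]]
  by (simp add: orbit_map_def)

lemma orbit_map_const: "mean \<phi> \<Longrightarrow> orbit_map \<phi> (\<lambda>n. c) = (\<lambda>n. c)"
  by (simp add: orbit_map_def mean_const)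

lemma orbit_map_pos:
  assumes "mean \<phi>" "x \<in> linf" "\<And>n. x n \<in> \<real>\<^sub>\<ge>\<^sub>0"
  shows "orbit_map \<phi> x n \<in> \<real>\<^sub>\<ge>\<^sub>0"
  unfolding orbit_map_def
  by (rule mean_pos[OF assms(1) linf_comp[OF assms(2)]]) (rule assms(3))

lemma c0_shift:
  assumes "x \<in> c0"
  shows "(\<lambda>m. x (m + n)) \<in> c0"
proof -
  have "Z \<le> m + n" if "m \<ge> Z - n" for Z m using that by linarith
  then have "filterlim (\<lambda>m. m + n) at_top at_top"
    unfolding filterlim_at_top eventually_at_top_linorder by blast
  moreover have "m + n \<le> Z" if "m \<le> Z - n" for Z m using that by linarith
  then have "filterlim (\<lambda>m. m + n) at_bot at_bot"
    unfolding filterlim_at_bot eventually_at_bot_linorder by blast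
  ultimately show ?thesis
    using assms unfolding c0_def by (auto intro: filterlim_compose[of x])
qed

lemma orbit_map_c0: "\<phi> \<in> K0 \<Longrightarrow> x \<in> c0 \<Longrightarrow> orbit_map \<phi> x = (\<lambda>n. 0)"
  by (simp add: orbit_map_def c0_shift K0_c0)

text \<open>Translating a character only multiplies it by a scalar, so the value of \<phi> at the
  character is the eigenvalue.\<close>

lemma orbit_map_xchar:
  assumes "mean \<phi>" "cmod l = 1"
  shows "orbit_map \<phi> (xchar l) = (\<lambda>n. \<phi> (xchar l) * xchar l n)"
proof
  fix n
  have "l \<noteq> 0" using assms(2) by auto
  then have "(\<lambda>m. xchar l (m + n)) = (\<lambda>m. xchar l n * xchar l m)"
    by (auto simp: xchar_def power_int_add)
  then show "orbit_map \<phi> (xchar l) n = \<phi> (xchar l) * xchar l n"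
    using assms by (simp add: orbit_map_def mean_scale)
qed

lemma conv_mean:
  assumes "mean \<phi>" "mean \<psi>"
  shows "mean (conv \<phi> \<psi>)"
  unfolding mean_def conv_def
proof (intro conjI ballI allI impI)
  fix x :: "int \<Rightarrow> complex" assume "x \<notin> linf"
  then show "\<phi> (orbit_map \<psi> x) = 0"
    using assms by (simp add: orbit_map_out mean_const)
next
  fix x :: "int \<Rightarrow> complex" assume "x \<in> linf" "\<forall>n. x n \<in> \<real>\<^sub>\<ge>\<^sub>0"
  then show "\<phi> (orbit_map \<psi> x) \<in> \<real>\<^sub>\<ge>\<^sub>0"
    by (intro mean_pos[OF assms(1)] orbit_map_pos[OF assms(2)] orbit_map_linf[OF assms(2)]) auto
next
  fix x y :: "int \<Rightarrow> complex" and a b :: complex assume xy: "x \<in> linf" "y \<in> linf"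
  show "\<phi> (orbit_map \<psi> (\<lambda>n. a * x n + b * y n)) = a * \<phi> (orbit_map \<psi> x) + b * \<phi> (orbit_map \<psi> y)"
    unfolding orbit_map_lin[OF assms(2) xy]
    by (rule mean_lin[OF assms(1) orbit_map_linf[OF assms(2)] orbit_map_linf[OF assms(2)]])
qed (simp add: orbit_map_const[OF assms(2)] mean_const[OF assms(1)])

text \<open>Under convolution the eigenvalues at each character multiply, and 0 and 1 are their own
  squares.\<close>

lemma conv_K0:
  assumes "\<phi> \<in> K0" "\<psi> \<in> K0"
  shows "conv \<phi> \<psi> \<in> K0"
proof -
  have m: "mean \<phi>" "mean \<psi>" using assms by (auto intro: K0_mean)
  have "conv \<phi> \<psi> x = 0" if "x \<in> c0" for x
    unfolding conv_def orbit_map_c0[OF assms(2) that] by (rule mean_const[OF m(1)])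
  moreover have "conv \<phi> \<psi> (xchar l) = (if l \<in> roots_of_unity then 1 else 0)" if "cmod l = 1" for l
    unfolding conv_def orbit_map_xchar[OF m(2) that]
    unfolding mean_scale[OF m(1) xchar_linf[OF that]] K0_xchar[OF assms(1) that] K0_xchar[OF assms(2) that]
    by simp
  ultimately show ?thesis
    using conv_mean[OF m] by (simp add: K0_def)
qed

lemma average_K0:
  assumes "\<And>k. f k \<in> K0" "n > 0"
  shows "(\<lambda>x. (\<Sum>k<n. f k x) / of_nat n) \<in> K0"
proof -
  have "mean (\<lambda>x. (\<Sum>k<n. f k x) / of_nat n)"
    using assms by (intro mean_average K0_mean)
  then show ?thesis
    using assms by (simp add: K0_def)
qed

section \<open>A multiplicative idempotent\<close>

text \<open>If \<open>L\<close> is a minimal closed left ideal and \<open>\<phi> \<in> L\<close>, the Cesaro averages of the convolution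
  powers of \<open>\<phi>\<close> cluster at some \<open>a = a * \<phi> \<in> L\<close>. So \<open>{\<theta> \<in> L. \<theta> * \<phi> = \<theta>}\<close> is a nonempty closed
  left ideal inside \<open>L\<close>, hence all of \<open>L\<close>.\<close>
lemma left_zero_ideal:
  obtains L where "closed L" "L \<noteq> {}" "L \<subseteq> K0"
    "\<And>\<theta> \<phi>. \<theta> \<in> K0 \<Longrightarrow> \<phi> \<in> L \<Longrightarrow> conv \<theta> \<phi> \<in> L"
    "\<And>\<theta> \<phi>. \<theta> \<in> L \<Longrightarrow> \<phi> \<in> L \<Longrightarrow> conv \<theta> \<phi> = \<theta>"
proof -
  \<comment> \<open>The closed left ideals of \<open>K0\<close>.\<close>
  define P where "P A \<longleftrightarrow> closed A \<and> A \<subseteq> K0 \<and> (\<forall>\<theta>\<in>K0. \<forall>\<phi>\<in>A. conv \<theta> \<phi> \<in> A)" for A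
  have "P K0" by (simp add: P_def closed_K0 conv_K0)
  moreover have "P (\<Inter>C)" if "C \<noteq> {}" "\<And>A. A \<in> C \<Longrightarrow> P A" for C
    unfolding P_def
  proof (intro conjI)
    show "closed (\<Inter>C)" using that by (intro closed_Inter) (simp add: P_def)
    show "\<Inter>C \<subseteq> K0" using that unfolding P_def by blast
    show "\<forall>\<theta>\<in>K0. \<forall>\<phi>\<in>\<Inter>C. conv \<theta> \<phi> \<in> \<Inter>C" using that(2) unfolding P_def by blast
  qed
  moreover have "closed A" if "P A" for A
    using that by (simp add: P_def)
  ultimately obtain L where L: "P L" "L \<noteq> {}" "L \<subseteq> K0"
    "\<And>B. P B \<Longrightarrow> B \<noteq> {} \<Longrightarrow> B \<subseteq> L \<Longrightarrow> B = L"
    by (rule minimal_closed_set[OF compact_K0, of P, OF _ _ _ K0_nonempty]) (assumption | blast)+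
  have ideal: "conv \<theta> \<phi> \<in> L" if "\<theta> \<in> K0" "\<phi> \<in> L" for \<theta> \<phi>
    using L(1) that by (simp add: P_def)
  have "conv \<theta> \<phi> = \<theta>" if "\<theta> \<in> L" and \<phi>: "\<phi> \<in> L" for \<theta> \<phi>
  proof -
    have \<phi>': "\<phi> \<in> K0" "mean \<phi>" using \<phi> L(3) K0_mean by auto
    define f where "f = rec_nat \<phi> (\<lambda>_ \<psi>. conv \<psi> \<phi>)"
    have f_Suc: "f (Suc k) = conv (f k) \<phi>" for k
      by (simp add: f_def)
    have f: "f k \<in> K0" for k
    proof (induction k)
      case 0
      then show ?case using \<phi>' by (simp add: f_def)
    qed (use \<phi>' in \<open>simp add: f_Suc conv_K0\<close>)
    define g where "g n x = (\<Sum>k<Suc n. f k x) / of_nat (Suc n)" for n x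
    have g: "g n \<in> K0" for n
      using average_K0[of f "Suc n"] f by (simp add: g_def[abs_def])
    have "\<exists>a\<in>K0. \<forall>x c. (\<lambda>n. g n x) \<longlonglongrightarrow> c \<longrightarrow> a x = c"
      by (rule compact_cluster[OF compact_K0]) (rule g)
    then obtain a where a: "a \<in> K0" "\<forall>x c. (\<lambda>n. g n x) \<longlonglongrightarrow> c \<longrightarrow> a x = c"
      by (rule bexE)
    have "conv a \<phi> x = a x" for x
    proof (cases "x \<in> linf")
      case False
      then show ?thesis
        using K0_mean[OF a(1)] \<phi>' conv_mean[of a \<phi>] by (simp add: mean_out)
    next
      case True
      then obtain M where M: "M > 0" "\<And>n. cmod (x n) \<le> M" by (rule linfE) blast
      define y where "y = orbit_map \<phi> x"
      have y: "y \<in> linf" unfolding y_def by (rule orbit_map_linf[OF \<phi>'(2)])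
      \<comment> \<open>On \<open>y - x\<close> the powers give consecutive differences, so their
        average telescopes to two bounded terms over \<open>Suc n\<close>. The cluster point
        \<open>a\<close> thus agrees on \<open>y\<close> and \<open>x\<close>, which is
        \<open>conv a \<phi> x = a x\<close>.\<close>
      have fz: "f k (\<lambda>n. y n - x n) = f (Suc k) x - f k x" for k
        using mean_diff[OF K0_mean[OF f] y True] by (simp add: f_Suc conv_def y_def)
      have gz: "g n (\<lambda>n. y n - x n) = (f (Suc n) x - f 0 x) / of_nat (Suc n)" for n
        unfolding g_def fz sum_lessThan_telescope[of "\<lambda>k. f k x"] ..
      have "cmod (g n (\<lambda>n. y n - x n)) \<le> 2 * M * inverse (real (Suc n))" for n
      proof -
        have "cmod (f (Suc n) x - f 0 x) \<le> cmod (f (Suc n) x) + cmod (f 0 x)"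
          by (rule norm_triangle_ineq4)
        also have "\<dots> \<le> M + M"
          by (intro add_mono mean_bound[OF K0_mean[OF f]] M)
        finally have "cmod (f (Suc n) x - f 0 x) / real (Suc n) \<le> 2 * M / real (Suc n)"
          by (intro divide_right_mono) auto
        then show ?thesis
          unfolding gz norm_divide norm_of_nat by (simp only: divide_inverse)
      qed
      then have "\<forall>\<^sub>F n in sequentially. cmod (g n (\<lambda>n. y n - x n)) \<le> 2 * M * inverse (real (Suc n))"
        by (rule always_eventually[OF allI])
      from Lim_null_comparison[OF this tendsto_mult_right_zero[OF LIMSEQ_inverse_real_of_nat]]
      have "a (\<lambda>n. y n - x n) = 0" using a(2) by simp
      then show ?thesis
        using mean_diff[OF K0_mean[OF a(1)] y True] by (simp add: conv_def y_def)
    qed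
    then have a_eq: "conv a \<phi> = a" by (rule ext)
    define S where "S = {\<theta> \<in> L. conv \<theta> \<phi> = \<theta>}"
    \<comment> \<open>A priori \<open>a\<close> lies only in \<open>K0\<close>; written as
      \<open>conv a \<phi>\<close> with \<phi> in the ideal, it belongs to \<open>L\<close>.\<close>
    have "a \<in> S" using ideal[OF a(1) \<phi>] a_eq by (simp add: S_def)
    moreover have "P S"
      unfolding P_def
    proof (intro conjI ballI)
      \<comment> \<open>Continuity of \<open>conv\<close> in its left factor: the defining equation
        of \<open>S\<close> compares two evaluations of \<theta>.\<close>
      have "S = L \<inter> (\<Inter>x. {\<theta>. \<theta> (orbit_map \<phi> x) = \<theta> x})"
        by (auto simp: S_def conv_def fun_eq_iff)
      moreover have "closed {\<theta>. \<theta> (orbit_map \<phi> x) = (\<theta> x :: complex)}" for x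
        by (rule closed_Collect_eq[OF continuous_on_eval[of UNIV "orbit_map \<phi> x"] continuous_on_eval[of UNIV x]])
      ultimately show "closed S"
        using L(1) by (simp add: P_def closed_INT closed_Int)
      show "S \<subseteq> K0" using L(3) by (auto simp: S_def)
      show "conv \<theta> \<psi> \<in> S" if "\<theta> \<in> K0" "\<psi> \<in> S" for \<theta> \<psi>
        using that ideal by (simp add: S_def conv_assoc)
    qed
    ultimately have "S = L" using L(4)[of S] by (auto simp: S_def)
    then show ?thesis using \<open>\<theta> \<in> L\<close> by (auto simp: S_def)
  qed
  with L ideal show ?thesis
    by (intro that[of L]) (auto simp: P_def)
qed

text \<open>The Krein-Milman argument. Each real functional built from an evaluation is constant on
  a minimal closed face, as the points where it attains its minimum form a smaller closed face;
  evaluations separate points, so the face is a singleton.\<close>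

lemma exists_extreme_point:
  fixes L :: "('a \<Rightarrow> complex) set"
  assumes "compact L" "closed L" "L \<noteq> {}"
  obtains \<phi> where "\<phi> \<in> L"
    "\<And>a b t. a \<in> L \<Longrightarrow> b \<in> L \<Longrightarrow> 0 < t \<Longrightarrow> t < 1 \<Longrightarrow>
      \<phi> = (\<lambda>x. of_real t * a x + of_real (1 - t) * b x) \<Longrightarrow> a = \<phi>"
proof -
  define mix where "mix t a b = (\<lambda>x. of_real t * a x + of_real (1 - t) * b x :: complex)"
    for t and a b :: "'a \<Rightarrow> complex"
  \<comment> \<open>The closed faces of \<open>L\<close>: whenever a proper mixture of two points of
    \<open>L\<close> lies in \<open>F\<close>, both points do.\<close>
  define P where "P F \<longleftrightarrow> closed F \<and> F \<subseteq> L \<and>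
    (\<forall>a\<in>L. \<forall>b\<in>L. \<forall>t. 0 < t \<longrightarrow> t < 1 \<longrightarrow> mix t a b \<in> F \<longrightarrow> a \<in> F \<and> b \<in> F)" for F
  have "P L" by (simp add: P_def assms)
  moreover have "P (\<Inter>C)" if "C \<noteq> {}" "\<And>A. A \<in> C \<Longrightarrow> P A" for C
    unfolding P_def
  proof (intro conjI)
    show "closed (\<Inter>C)" using that by (intro closed_Inter) (simp add: P_def)
    show "\<Inter>C \<subseteq> L" using that unfolding P_def by blast
    show "\<forall>a\<in>L. \<forall>b\<in>L. \<forall>t. 0 < t \<longrightarrow> t < 1 \<longrightarrow> mix t a b \<in> \<Inter>C \<longrightarrow> a \<in> \<Inter>C \<and> b \<in> \<Inter>C"
      using that(2) unfolding P_def by blast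
  qed
  moreover have "closed A" if "P A" for A
    using that by (simp add: P_def)
  ultimately obtain F where F: "P F" "F \<noteq> {}" "F \<subseteq> L"
    "\<And>B. P B \<Longrightarrow> B \<noteq> {} \<Longrightarrow> B \<subseteq> F \<Longrightarrow> B = F"
    by (rule minimal_closed_set[OF assms(1), of P, OF _ _ _ assms(3)]) (assumption | blast)+
  have "closed F" using F(1) by (simp add: P_def)
  have "compact F"
    using compact_Int_closed[OF assms(1) \<open>closed F\<close>] F(3) by (simp add: Int_absorb1)
  have const: "Re (c * \<psi>1 x) = Re (c * \<psi>2 x)" if "\<psi>1 \<in> F" "\<psi>2 \<in> F" for c x \<psi>1 \<psi>2
  proof -
    have cont: "continuous_on S (\<lambda>\<psi>. Re (c * \<psi> x))" for S
      by (intro continuous_on_Re continuous_on_mult_left continuous_on_eval[of _ x])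
    obtain \<phi> where \<phi>: "\<phi> \<in> F" "\<And>\<psi>. \<psi> \<in> F \<Longrightarrow> Re (c * \<phi> x) \<le> Re (c * \<psi> x)"
      using continuous_attains_inf[OF \<open>compact F\<close> F(2) cont] by blast
    define G where "G = {\<psi> \<in> F. Re (c * \<psi> x) = Re (c * \<phi> x)}"
    have "P G"
      unfolding P_def
    proof (intro conjI ballI allI impI)
      have "G = F \<inter> {\<psi>. Re (c * \<psi> x) = Re (c * \<phi> x)}" by (auto simp: G_def)
      then show "closed G"
        using \<open>closed F\<close> closed_Collect_eq[OF cont continuous_on_const] by (simp add: closed_Int)
      show "G \<subseteq> L" using F(3) by (auto simp: G_def)
      fix a b t assume *: "a \<in> L" "b \<in> L" "0 < t" "t < (1::real)" "mix t a b \<in> G"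
      then have ab: "a \<in> F" "b \<in> F"
        using F(1) by (auto simp: P_def G_def)
      define p q r where "p = Re (c * a x)" and "q = Re (c * b x)" and "r = Re (c * \<phi> x)"
      have "Re (c * mix t a b x) = t * p + (1 - t) * q"
        by (simp add: mix_def p_def q_def algebra_simps)
      then have "r = t * p + (1 - t) * q"
        using *(5) by (simp add: G_def r_def)
      \<comment> \<open>The minimum \<open>r\<close> is a weighted mean of \<open>p\<close> and
        \<open>q\<close>, neither of which is below \<open>r\<close>; as both weights are positive,
        both equal \<open>r\<close>.\<close>
      then have "t * (p - r) + (1 - t) * (q - r) = 0" by (simp add: algebra_simps)
      moreover have "p - r \<ge> 0" "q - r \<ge> 0"
        using \<phi>(2) ab by (auto simp: p_def q_def r_def)
      ultimately have "t * (p - r) = 0" "(1 - t) * (q - r) = 0"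
        using *(3,4) by (simp_all add: add_nonneg_eq_0_iff)
      then have "p = r" "q = r" using *(3,4) by auto
      then show "a \<in> G" "b \<in> G"
        using ab by (auto simp: G_def p_def q_def r_def)
    qed
    then have "G = F" using F(4)[of G] \<phi>(1) by (auto simp: G_def)
    then have "\<psi>1 \<in> G" "\<psi>2 \<in> G" using that by auto
    then show ?thesis by (simp add: G_def)
  qed
  have eq: "\<psi>1 = \<psi>2" if "\<psi>1 \<in> F" "\<psi>2 \<in> F" for \<psi>1 \<psi>2
  proof
    fix x
    show "\<psi>1 x = \<psi>2 x"
      \<comment> \<open>The factor 1 gives the real parts and the factor \<open>-\<i>\<close> the
        imaginary parts.\<close>
      using const[OF that, of 1 x] const[OF that, of "-\<i>" x] by (simp add: complex_eq_iff)
  qed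
  obtain \<phi> where \<phi>: "\<phi> \<in> F" using F(2) by blast
  show ?thesis
  proof (rule that[of \<phi>])
    show "\<phi> \<in> L" using \<phi> F(3) by blast
    fix a b t assume *: "a \<in> L" "b \<in> L" "0 < t" "t < (1::real)"
      "\<phi> = (\<lambda>x. of_real t * a x + of_real (1 - t) * b x)"
    have "mix t a b \<in> F"
      unfolding mix_def *(5)[symmetric] by (rule \<phi>)
    then have "a \<in> F" using F(1) *(1-4) unfolding P_def by blast
    then show "a = \<phi>" using \<phi> by (rule eq)
  qed
qed

section \<open>Reweighting a mean by a nonnegative density\<close>

lemma cmod_xchar: "cmod l = 1 \<Longrightarrow> cmod (xchar l n) = 1"
  by (simp add: xchar_def norm_power_int)

text \<open>\<open>\<phi>(xchar l) = 1\<close> gives \<open>\<phi>(\<bar>z\<bar>\<^sup>2) = 0\<close> for \<open>z = xchar l - 1\<close>, and \<open>\<bar>z\<bar> \<le> e + \<bar>z\<bar>\<^sup>2 / e\<close> replaces the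
  Cauchy-Schwarz inequality.\<close>
lemma mean_mult_xchar:
  assumes \<phi>: "mean \<phi>" and l: "cmod l = 1" "\<phi> (xchar l) = 1" and w: "w \<in> linf"
  shows "\<phi> (\<lambda>n. w n * xchar l n) = \<phi> w"
proof -
  define z where "z n = xchar l n - 1" for n
  have xl: "xchar l \<in> linf" using l by simp
  have z: "z \<in> linf"
    unfolding z_def using linf_diff[OF xl linf_const] .
  \<comment> \<open>Since \<open>xchar l\<close> is unimodular, the square is affine in
    \<open>xchar l\<close> and its conjugate, so \<phi> of it is 2 - (1 + 1).\<close>
  have zz: "complex_of_real ((cmod (z n))\<^sup>2) = 2 - (xchar l n + cnj (xchar l n))" for n
  proof -
    have "xchar l n * cnj (xchar l n) = 1"
      using complex_norm_square[of "xchar l n"] cmod_xchar[OF l(1)] by simp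
    then show ?thesis
      unfolding complex_norm_square z_def by (simp add: algebra_simps)
  qed
  have zz_linf: "(\<lambda>n. complex_of_real ((cmod (z n))\<^sup>2)) \<in> linf"
    unfolding zz by (intro linf_diff linf_const linf_add linf_cnj xl)
  have zz0: "\<phi> (\<lambda>n. complex_of_real ((cmod (z n))\<^sup>2)) = 0"
    unfolding zz mean_diff[OF \<phi> linf_const linf_add[OF xl linf_cnj[OF xl]]]
      mean_add[OF \<phi> xl linf_cnj[OF xl]] mean_cnj[OF \<phi> xl] mean_const[OF \<phi>] l(2)
    by simp
  obtain M where M: "M > 0" "\<And>n. cmod (w n) \<le> M" using w by (rule linfE) blast
  have wz: "(\<lambda>n. w n * z n) \<in> linf" using w z by (rule linf_mult)
  have "cmod (\<phi> (\<lambda>n. w n * z n)) \<le> M * e" if e: "e > 0" for e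
  proof -
    have le: "cmod (w n * z n) \<le> M * e + M / e * (cmod (z n))\<^sup>2" for n
    proof -
      have "cmod (z n) * e \<le> e\<^sup>2 + (cmod (z n))\<^sup>2"
      proof -
        have "2 * (cmod (z n) * e) \<le> e\<^sup>2 + (cmod (z n))\<^sup>2" "0 \<le> cmod (z n) * e"
          using sum_squares_bound[of e "cmod (z n)"] e by (simp_all add: mult_ac)
        then show ?thesis by linarith
      qed
      then have "cmod (z n) \<le> e + (cmod (z n))\<^sup>2 / e"
        using e by (simp add: field_simps power2_eq_square)
      then have "cmod (w n) * cmod (z n) \<le> M * (e + (cmod (z n))\<^sup>2 / e)"
        using M by (intro mult_mono) auto
      then show ?thesis by (simp add: norm_mult algebra_simps)
    qed
    have lin: "(\<lambda>n. complex_of_real (M * e + M / e * (cmod (z n))\<^sup>2)) =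
        (\<lambda>n. of_real (M * e) * 1 + of_real (M / e) * of_real ((cmod (z n))\<^sup>2))"
      by simp
    have "cmod (\<phi> (\<lambda>n. w n * z n)) \<le> Re (\<phi> (\<lambda>n. of_real (cmod (w n * z n))))"
      by (rule mean_abs[OF \<phi> wz])
    also have "\<dots> \<le> Re (\<phi> (\<lambda>n. of_real (M * e + M / e * (cmod (z n))\<^sup>2)))"
    proof (rule mean_mono[OF \<phi> linf_cmod[OF wz] _ le])
      show "(\<lambda>n. complex_of_real (M * e + M / e * (cmod (z n))\<^sup>2)) \<in> linf"
        unfolding lin by (intro linf_add linf_mult linf_const zz_linf)
    qed
    also have "\<dots> = M * e"
      unfolding lin mean_lin[OF \<phi> linf_const zz_linf] zz0 mean_one[OF \<phi>] by simp
    finally show ?thesis .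
  qed
  from this[of "e / M" for e] have "cmod (\<phi> (\<lambda>n. w n * z n)) \<le> e" if "e > 0" for e
    using M(1) that by simp
  then have "\<phi> (\<lambda>n. w n * z n) = 0"
    by (metis field_le_epsilon add_0 norm_le_zero_iff)
  moreover have "\<phi> (\<lambda>n. w n * z n) = \<phi> (\<lambda>n. w n * xchar l n) - \<phi> w"
    using mean_diff[OF \<phi> linf_mult[OF w xl] w] by (simp add: z_def algebra_simps)
  ultimately show ?thesis by simp
qed

text \<open>The density multiplies \<open>orbit_map \<phi> x\<close> instead of \<open>x\<close>, so
  that for idempotent \<phi> right convolution by \<phi> leaves the tilt unchanged.\<close>

definition tilt :: "((int \<Rightarrow> complex) \<Rightarrow> complex) \<Rightarrow> (int \<Rightarrow> complex) \<Rightarrow> (int \<Rightarrow> complex) \<Rightarrow> complex" where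
  "tilt \<phi> w = (\<lambda>x. \<phi> (\<lambda>n. w n * orbit_map \<phi> x n) / \<phi> w)"

text \<open>\<open>orbit_map \<phi>\<close> already annihilates \<open>c0\<close> and the characters
  outside the roots of unity. The other characters are fixed by it, and there
  \<open>mean_mult_xchar\<close> removes the character next to \<open>w\<close>.\<close>

lemma tilt_K0:
  assumes \<phi>: "\<phi> \<in> K0" and w: "w \<in> linf" "\<And>n. w n \<in> \<real>\<^sub>\<ge>\<^sub>0" "\<phi> w \<noteq> 0"
  shows "tilt \<phi> w \<in> K0"
proof -
  have m: "mean \<phi>" using \<phi> by (rule K0_mean)
  have wo: "(\<lambda>n. w n * orbit_map \<phi> x n) \<in> linf" for x
    using w(1) orbit_map_linf[OF m] by (rule linf_mult)
  have zero: "\<phi> (\<lambda>n. w n * 0) = 0"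
    using mean_const[OF m, of 0] by simp
  have "mean (tilt \<phi> w)"
    unfolding mean_def
  proof (intro conjI ballI allI impI)
    fix x :: "int \<Rightarrow> complex" assume "x \<notin> linf"
    then show "tilt \<phi> w x = 0"
      using zero by (simp add: tilt_def orbit_map_out[OF m])
  next
    fix x y :: "int \<Rightarrow> complex" and a b :: complex assume xy: "x \<in> linf" "y \<in> linf"
    have "(\<lambda>n. w n * orbit_map \<phi> (\<lambda>n. a * x n + b * y n) n) =
      (\<lambda>n. a * (w n * orbit_map \<phi> x n) + b * (w n * orbit_map \<phi> y n))"
      unfolding orbit_map_lin[OF m xy] by (simp add: algebra_simps)
    then show "tilt \<phi> w (\<lambda>n. a * x n + b * y n) = a * tilt \<phi> w x + b * tilt \<phi> w y"
      unfolding tilt_def using mean_lin[OF m wo wo, of a x b y] by (simp add: add_divide_distrib)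
  next
    show "tilt \<phi> w (\<lambda>n. 1) = 1"
      using w(3) by (simp add: tilt_def orbit_map_const[OF m])
  next
    fix x :: "int \<Rightarrow> complex" assume x: "x \<in> linf" "\<forall>n. x n \<in> \<real>\<^sub>\<ge>\<^sub>0"
    have "\<phi> (\<lambda>n. w n * orbit_map \<phi> x n) \<in> \<real>\<^sub>\<ge>\<^sub>0"
    proof (rule mean_pos[OF m wo])
      show "w n * orbit_map \<phi> x n \<in> \<real>\<^sub>\<ge>\<^sub>0" for n
        using x by (intro nonneg_Reals_mult_I w(2) orbit_map_pos[OF m]) auto
    qed
    then show "tilt \<phi> w x \<in> \<real>\<^sub>\<ge>\<^sub>0"
      unfolding tilt_def using mean_pos[OF m w(1,2)] by (rule nonneg_Reals_divide_I)
  qed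
  moreover have "tilt \<phi> w x = 0" if "x \<in> c0" for x
    using zero by (simp add: tilt_def orbit_map_c0[OF \<phi> that])
  moreover have "tilt \<phi> w (xchar l) = (if l \<in> roots_of_unity then 1 else 0)" if l: "cmod l = 1" for l
    using zero mean_mult_xchar[OF m l _ w(1)] w(3)
    by (simp add: tilt_def orbit_map_xchar[OF m l] K0_xchar[OF \<phi> l])
  ultimately show ?thesis by (simp add: K0_def)
qed

text \<open>\<open>\<phi>\<close> is a convex combination of \<open>tilt \<phi> w\<close> and \<open>tilt \<phi> (1 - w)\<close>, both in \<open>L\<close>; extremality
  forces \<open>tilt \<phi> w = \<phi>\<close>, which says that \<open>\<phi>\<close> is multiplicative on the range of \<open>orbit_map \<phi>\<close>.\<close>
lemma multiplicative_idempotent: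
  obtains \<phi> where "\<phi> \<in> K0" "conv \<phi> \<phi> = \<phi>"
    "\<And>x y. x \<in> linf \<Longrightarrow> y \<in> linf \<Longrightarrow> \<phi> (\<lambda>n. y n * orbit_map \<phi> x n) = \<phi> y * \<phi> x"
proof -
  obtain L where L: "closed L" "L \<noteq> {}" "L \<subseteq> K0"
    and ideal: "\<And>\<theta> \<phi>. \<theta> \<in> K0 \<Longrightarrow> \<phi> \<in> L \<Longrightarrow> conv \<theta> \<phi> \<in> L"
    and zero: "\<And>\<theta> \<phi>. \<theta> \<in> L \<Longrightarrow> \<phi> \<in> L \<Longrightarrow> conv \<theta> \<phi> = \<theta>"
    by (rule left_zero_ideal) blast
  have "compact L"
    using compact_Int_closed[OF compact_K0 L(1)] L(3) by (simp add: Int_absorb1)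
  obtain \<phi> where \<phi>: "\<phi> \<in> L" and extreme: "\<And>a b t. a \<in> L \<Longrightarrow> b \<in> L \<Longrightarrow> 0 < t \<Longrightarrow> t < 1 \<Longrightarrow>
      \<phi> = (\<lambda>x. of_real t * a x + of_real (1 - t) * b x) \<Longrightarrow> a = \<phi>"
    by (rule exists_extreme_point[OF \<open>compact L\<close> L(1,2)]) blast
  have K: "\<phi> \<in> K0" and m: "mean \<phi>" using \<phi> L(3) K0_mean by auto
  have idem: "conv \<phi> \<phi> = \<phi>" by (rule zero[OF \<phi> \<phi>])
  have orbit_idem: "orbit_map \<phi> (orbit_map \<phi> x) = orbit_map \<phi> x" for x
    by (metis idem orbit_map_conv)
  have tilt_L: "tilt \<phi> w \<in> L" if "w \<in> linf" "\<And>n. w n \<in> \<real>\<^sub>\<ge>\<^sub>0" "\<phi> w \<noteq> 0" for w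
  proof -
    \<comment> \<open>A tilt is an element of \<open>K0\<close> that equals its own convolution with
      \<phi>, so the ideal property places it in \<open>L\<close>.\<close>
    have "conv (tilt \<phi> w) \<phi> = tilt \<phi> w"
      by (simp add: conv_def tilt_def orbit_idem)
    then show ?thesis using ideal[OF tilt_K0[OF K that] \<phi>] by simp
  qed
  have prod_linf: "(\<lambda>n. w n * orbit_map \<phi> x n) \<in> linf" if "w \<in> linf" for w x
    by (rule linf_mult[OF that orbit_map_linf[OF m]])
  \<comment> \<open>The bounds 1/4 and 3/4 keep the weights \<open>\<phi> w\<close> and
    \<open>\<phi> (1 - w)\<close> strictly between 0 and 1, as extremality requires.\<close>
  have step: "\<phi> (\<lambda>n. of_real (u n) * orbit_map \<phi> x n) = \<phi> (\<lambda>n. of_real (u n)) * \<phi> x"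
    if u: "\<And>n. 1/4 \<le> u n" "\<And>n. u n \<le> 3/4" for u x
  proof -
    define w where "w n = complex_of_real (u n)" for n
    have w: "w \<in> linf"
    proof (rule linfI)
      show "cmod (w n) \<le> 3/4" for n using u[of n] by (simp add: w_def)
    qed
    define t where "t = Re (\<phi> w)"
    have t: "\<phi> w = of_real t"
      using mean_real[OF m, of u] w by (simp add: complex_eq_iff t_def w_def[abs_def])
    have "Re (\<phi> (\<lambda>n. of_real (1/4))) \<le> t" "t \<le> Re (\<phi> (\<lambda>n. of_real (3/4)))"
      using mean_mono[OF m, of "\<lambda>_. 1/4" u] mean_mono[OF m, of u "\<lambda>_. 3/4"] linf_const w u
      unfolding t_def w_def by blast+
    then have t01: "0 < t" "t < 1" by (simp_all add: mean_const[OF m])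
    have w': "(\<lambda>n. 1 - w n) \<in> linf" using linf_diff[OF linf_const w] .
    have t': "\<phi> (\<lambda>n. 1 - w n) = of_real (1 - t)"
      using mean_diff[OF m linf_const w, of 1] mean_one[OF m] t by simp
    have "tilt \<phi> w = \<phi>"
    proof (rule extreme[OF tilt_L[OF w] tilt_L[OF w'] t01])
      show "w n \<in> \<real>\<^sub>\<ge>\<^sub>0" for n
        using u(1)[of n] by (simp add: w_def complex_nonneg_Reals_iff)
      show "1 - w n \<in> \<real>\<^sub>\<ge>\<^sub>0" for n
        using u(2)[of n] by (simp add: w_def complex_nonneg_Reals_iff)
      show "\<phi> w \<noteq> 0" using t t01 by simp
      show "\<phi> (\<lambda>n. 1 - w n) \<noteq> 0" using t' t01 by (metis diff_gt_0_iff_gt of_real_eq_0_iff less_irrefl)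
      show "\<phi> = (\<lambda>x. of_real t * tilt \<phi> w x + of_real (1 - t) * tilt \<phi> (\<lambda>n. 1 - w n) x)"
      proof
        fix x
        \<comment> \<open>Idempotence inserts \<open>orbit_map \<phi>\<close>, which is then split
          by 1 = w + (1 - w).\<close>
        have "\<phi> x = \<phi> (orbit_map \<phi> x)"
          by (metis idem conv_def)
        also have "\<dots> = \<phi> (\<lambda>n. w n * orbit_map \<phi> x n + (1 - w n) * orbit_map \<phi> x n)"
          by (simp add: algebra_simps)
        also have "\<dots> = \<phi> (\<lambda>n. w n * orbit_map \<phi> x n) + \<phi> (\<lambda>n. (1 - w n) * orbit_map \<phi> x n)"
          by (rule mean_add[OF m prod_linf[OF w] prod_linf[OF w']])
        also have "\<dots> = of_real t * tilt \<phi> w x + of_real (1 - t) * tilt \<phi> (\<lambda>n. 1 - w n) x"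
        proof -
          have "of_real t \<noteq> (0::complex)" "of_real (1 - t) \<noteq> (0::complex)"
            using t01 by (simp_all only: of_real_eq_0_iff)
          then show ?thesis
            unfolding tilt_def t t' by (simp only: times_divide_eq_right nonzero_mult_div_cancel_left not_False_eq_True)
        qed
        finally show "\<phi> x = of_real t * tilt \<phi> w x + of_real (1 - t) * tilt \<phi> (\<lambda>n. 1 - w n) x" .
      qed
    qed
    then have "\<phi> (\<lambda>n. w n * orbit_map \<phi> x n) / \<phi> w = \<phi> x"
      unfolding tilt_def by (rule fun_cong)
    then show ?thesis
      using t t01 by (simp add: w_def[abs_def] field_simps)
  qed
  have real_case: "\<phi> (\<lambda>n. of_real (u n) * orbit_map \<phi> x n) = \<phi> (\<lambda>n. of_real (u n)) * \<phi> x"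
    if u: "(\<lambda>n. of_real (u n)) \<in> linf" for u x
  proof -
    obtain M where M: "M > 0" "\<And>n. cmod (of_real (u n)) \<le> M"
      using u by (rule linfE) blast
    \<comment> \<open>An affine change brings any bounded real sequence into [1/4, 3/4]. The claim
      is affine in the density and true for the constant 1/2 by idempotence, so it passes from
      \<open>v\<close> back to \<open>u\<close>.\<close>
    define v where "v n = 1/2 + u n / (4 * M)" for n
    have "1/4 \<le> v n" "v n \<le> 3/4" for n
      using M(2)[of n] M(1) by (auto simp: v_def field_simps abs_le_iff)
    note s = step[of v x, OF this]
    define d where "d = complex_of_real (1 / (4 * M))"
    have v: "complex_of_real (v n) = 1/2 * 1 + d * of_real (u n)" for n
      by (simp add: v_def d_def)
    have d: "d \<noteq> 0" using M(1) by (simp add: d_def)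
    have "\<phi> (\<lambda>n. of_real (v n)) = 1/2 + d * \<phi> (\<lambda>n. of_real (u n))"
      unfolding v using mean_lin[OF m linf_const u, of "1/2" 1 d] mean_one[OF m] by simp
    moreover have "\<phi> (\<lambda>n. of_real (v n) * orbit_map \<phi> x n) =
        1/2 * \<phi> x + d * \<phi> (\<lambda>n. of_real (u n) * orbit_map \<phi> x n)"
    proof -
      have "(\<lambda>n. of_real (v n) * orbit_map \<phi> x n) =
        (\<lambda>n. 1/2 * orbit_map \<phi> x n + d * (of_real (u n) * orbit_map \<phi> x n))"
        unfolding v by (simp add: algebra_simps)
      moreover have "\<phi> (orbit_map \<phi> x) = \<phi> x" by (metis idem conv_def)
      ultimately show ?thesis
        using mean_lin[OF m orbit_map_linf[OF m] prod_linf[OF u], of "1/2" x d x] by simp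
    qed
    ultimately show ?thesis
      using s d by (auto simp: algebra_simps)
  qed
  show ?thesis
  proof (rule that[OF K idem])
    fix x y :: "int \<Rightarrow> complex" assume y: "y \<in> linf"
    have "(\<lambda>n. y n * orbit_map \<phi> x n) = (\<lambda>n. 1 * (of_real (Re (y n)) * orbit_map \<phi> x n) +
        \<i> * (of_real (Im (y n)) * orbit_map \<phi> x n))"
      by (simp add: algebra_simps flip: complex_eq distrib_right) (metis complex_eq distrib_right mult.assoc mult.commute)
    then have "\<phi> (\<lambda>n. y n * orbit_map \<phi> x n) = \<phi> (\<lambda>n. of_real (Re (y n)) * orbit_map \<phi> x n) +
        \<i> * \<phi> (\<lambda>n. of_real (Im (y n)) * orbit_map \<phi> x n)"
      using mean_lin[OF m prod_linf[OF linf_Re[OF y]] prod_linf[OF linf_Im[OF y]], of 1 x \<i> x] by simp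
    also have "\<dots> = (\<phi> (\<lambda>n. of_real (Re (y n))) + \<i> * \<phi> (\<lambda>n. of_real (Im (y n)))) * \<phi> x"
      unfolding real_case[OF linf_Re[OF y]] real_case[OF linf_Im[OF y]] by (simp add: algebra_simps)
    also have "\<dots> = \<phi> y * \<phi> x"
      by (simp flip: mean_Re_Im[OF m y])
    finally show "\<phi> (\<lambda>n. y n * orbit_map \<phi> x n) = \<phi> y * \<phi> x" .
  qed
qed

section \<open>The roots of unity as the spectrum\<close>

lemma roots_of_unity_sphere: "roots_of_unity \<subseteq> sphere 0 1"
  using power_eq_1_iff by (fastforce simp: roots_of_unity_def)

lemma subgroup_roots_of_unity: "subgroup_T roots_of_unity"
  unfolding subgroup_T_def
proof (intro conjI ballI)
  fix a b assume "a \<in> roots_of_unity" "b \<in> roots_of_unity"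
  then obtain k m where k: "k > 0" "a ^ k = 1" and m: "m > 0" "b ^ m = 1"
    by (auto simp: roots_of_unity_def)
  have "a ^ (k * m) = 1"
    unfolding power_mult k(2) by simp
  moreover have "b ^ (k * m) = 1"
    unfolding mult.commute[of k m] power_mult m(2) by simp
  ultimately have "(a * b) ^ (k * m) = 1"
    by (simp add: power_mult_distrib)
  then show "a * b \<in> roots_of_unity"
    unfolding roots_of_unity_def using k(1) m(1) by (intro CollectI exI[of _ "k * m"]) simp
next
  fix a assume "a \<in> roots_of_unity"
  then show "inverse a \<in> roots_of_unity"
    by (auto simp: roots_of_unity_def power_inverse)
next
  show "1 \<in> roots_of_unity" by (auto simp: roots_of_unity_def intro: exI[of _ 1])
qed (rule roots_of_unity_sphere)

lemma cis_rational_root_of_unity: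
  assumes "r \<in> \<rat>"
  shows "cis (2 * pi * r) \<in> roots_of_unity"
proof -
  obtain m :: int and n :: nat where mn: "n > 0" "r = real_of_int m / real n"
    using Rats_cases'[OF assms] by (metis of_nat_0_less_iff pos_int_cases of_int_of_nat_eq)
  have "real n * (2 * pi * r) = 2 * pi * m"
    using mn by simp
  then have "cis (2 * pi * r) ^ n = cis (2 * pi * m)"
    unfolding Complex.DeMoivre by (rule arg_cong)
  also have "\<dots> = 1"
    by (rule cis_multiple_2pi) simp
  finally show ?thesis using mn(1) by (auto simp: roots_of_unity_def)
qed

text \<open>The continuous map sending \<open>r\<close> to \<open>cis (2 * pi * r)\<close> takes
  rationals to roots of unity and the reals, their closure, onto the circle.\<close>

lemma closure_roots_of_unity: "closure roots_of_unity = sphere 0 1"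
proof
  show "closure roots_of_unity \<subseteq> sphere 0 1"
    by (rule closure_minimal[OF roots_of_unity_sphere closed_sphere])
  show "sphere 0 1 \<subseteq> closure roots_of_unity"
  proof
    fix z :: complex assume "z \<in> sphere 0 1"
    then have "cmod z = 1" "z \<noteq> 0" by auto
    then have z: "z = cis (2 * pi * (Arg z / (2 * pi)))"
      using cis_Arg[of z] by (simp add: sgn_eq)
    have "(\<lambda>r. cis (2 * pi * r)) ` closure \<rat> \<subseteq> closure roots_of_unity"
      by (intro image_closure_subset continuous_intros closed_closure)
        (use cis_rational_root_of_unity closure_subset in blast)
    then show "z \<in> closure roots_of_unity"
      unfolding Rats_closure_real using z by blast
  qed
qed

text \<open>Cardinality: a countable union of finite sets against a connected set with two
  points.\<close>

lemma roots_of_unity_proper: "roots_of_unity \<noteq> sphere 0 1"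
proof
  assume eq: "roots_of_unity = sphere 0 1"
  have "roots_of_unity = (\<Union>k\<in>{0<..}. {l :: complex. l ^ k = 1})"
    by (auto simp: roots_of_unity_def)
  also have "countable \<dots>"
    by (intro countable_UN) (auto intro!: countable_finite finite_roots_unity)
  finally have "countable (sphere (0::complex) 1)" by (simp add: eq)
  moreover have "uncountable (sphere (0::complex) 1)"
    by (rule connected_uncountable[of _ 1 "-1"]) (simp_all add: connected_sphere)
  ultimately show False by contradiction
qed

section \<open>The idempotent map, its range algebra and its spectrum\<close>

theorem theorem2p14:
  shows "\<exists>\<Phi> :: (int \<Rightarrow> complex) \<Rightarrow> (int \<Rightarrow> complex).
     is_linear_linf \<Phi> \<and>
     \<Phi> (\<lambda>n. 1) = (\<lambda>n. 1) \<and>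
     completely_positive \<Phi> \<and>
     (\<forall>x\<in>linf. \<Phi> (\<Phi> x) = \<Phi> x) \<and>
     (\<forall>x\<in>linf. \<Phi> (bshift x) = bshift (\<Phi> x)) \<and>
     cstar_subalgebra (\<Phi> ` linf) \<and>
     (\<exists>x\<in>linf. \<exists>y\<in>linf. \<Phi> (\<lambda>n. x n * y n) \<noteq> (\<lambda>n. \<Phi> x n * \<Phi> y n)) \<and>
     (\<forall>x\<in>c0. \<Phi> x = (\<lambda>n. 0)) \<and>
     subgroup_T (spec \<Phi>) \<and>
     closure (spec \<Phi>) = sphere 0 1 \<and>
     spec \<Phi> \<noteq> sphere 0 1"
proof -
  obtain \<phi> where K: "\<phi> \<in> K0" and idem: "conv \<phi> \<phi> = \<phi>"
    and mult: "\<And>x y. x \<in> linf \<Longrightarrow> y \<in> linf \<Longrightarrow> \<phi> (\<lambda>n. y n * orbit_map \<phi> x n) = \<phi> y * \<phi> x"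
    by (rule multiplicative_idempotent) blast
  have m: "mean \<phi>" using K by (rule K0_mean)
  define \<Phi> where "\<Phi> = orbit_map \<phi>"
  have linf: "\<Phi> x \<in> linf" for x
    unfolding \<Phi>_def by (rule orbit_map_linf[OF m])
  have lin: "\<Phi> (\<lambda>n. a * x n + b * y n) = (\<lambda>n. a * \<Phi> x n + b * \<Phi> y n)"
    if "x \<in> linf" "y \<in> linf" for x y a b
    unfolding \<Phi>_def by (rule orbit_map_lin[OF m that])
  have idem_\<Phi>: "\<Phi> (\<Phi> x) = \<Phi> x" for x
    unfolding \<Phi>_def by (metis idem orbit_map_conv)
  \<comment> \<open>The functional identity applied to all translates becomes the module property of
    a conditional expectation.\<close>
  have mult_\<Phi>: "\<Phi> (\<lambda>n. y n * \<Phi> x n) = (\<lambda>n. \<Phi> y n * \<Phi> x n)" if "x \<in> linf" "y \<in> linf" for x y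
  proof
    fix n
    show "\<Phi> (\<lambda>n. y n * \<Phi> x n) n = \<Phi> y n * \<Phi> x n"
      using mult[of "\<lambda>m. x (m + n)" "\<lambda>m. y (m + n)"] linf_comp[OF that(1)] linf_comp[OF that(2)]
      unfolding orbit_map_shift by (simp add: \<Phi>_def orbit_map_def)
  qed
  \<comment> \<open>By idempotence the range is the set of fixed points, which reduces each algebra
    axiom to an identity.\<close>
  have range: "x \<in> \<Phi> ` linf \<longleftrightarrow> x \<in> linf \<and> \<Phi> x = x" for x
    using linf idem_\<Phi> by (metis image_iff)
  have char: "\<Phi> (xchar l) = (\<lambda>n. (if l \<in> roots_of_unity then 1 else 0) * xchar l n)" if "cmod l = 1" for l
    unfolding \<Phi>_def orbit_map_xchar[OF m that] K0_xchar[OF K that] ..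
  have "is_linear_linf \<Phi>"
    using linf lin by (simp add: is_linear_linf_def)
  moreover have "\<Phi> (\<lambda>n. 1) = (\<lambda>n. 1)"
    unfolding \<Phi>_def by (rule orbit_map_const[OF m])
  moreover have "completely_positive \<Phi>"
    unfolding completely_positive_def
  proof (intro allI impI)
    fix n :: nat and X :: "nat \<Rightarrow> nat \<Rightarrow> int \<Rightarrow> complex" and k :: int
    assume "(\<forall>i<n. \<forall>j<n. X i j \<in> linf) \<and> (\<forall>k. psd_mat n (\<lambda>i j. X i j k))"
    then have X: "\<And>i j. i < n \<Longrightarrow> j < n \<Longrightarrow> X i j \<in> linf" and psd: "\<And>k. psd_mat n (\<lambda>i j. X i j k)"
      by auto
    have "(\<Sum>i<n. \<Sum>j<n. cnj (v i) * \<Phi> (X i j) k * v j) \<in> \<real>\<^sub>\<ge>\<^sub>0" for v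
    proof -
      \<comment> \<open>The quadratic form of the image matrix at \<open>k\<close> is \<phi> applied
        to the quadratic form of \<open>X\<close> translated by \<open>k\<close>, so positivity of
        the scalar functional suffices for every matrix size.\<close>
      define Y where "Y i j p = cnj (v i) * v j * X i j (p + k)" for i j p
      have Y: "Y i j \<in> linf" if "i < n" "j < n" for i j
        unfolding Y_def by (intro linf_mult linf_const linf_comp[OF X[OF that]])
      have "\<phi> (\<lambda>p. \<Sum>i<n. \<Sum>j<n. Y i j p) \<in> \<real>\<^sub>\<ge>\<^sub>0"
      proof (rule mean_pos[OF m])
        show "(\<lambda>p. \<Sum>i<n. \<Sum>j<n. Y i j p) \<in> linf"
          by (intro linf_sum Y) auto
        show "(\<Sum>i<n. \<Sum>j<n. Y i j p) \<in> \<real>\<^sub>\<ge>\<^sub>0" for p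
          using psd[of "p + k"]
          by (simp add: psd_mat_def Let_def complex_nonneg_Reals_iff Y_def mult_ac)
      qed
      also have "\<phi> (\<lambda>p. \<Sum>i<n. \<Sum>j<n. Y i j p) = (\<Sum>i<n. \<phi> (\<lambda>p. \<Sum>j<n. Y i j p))"
        by (rule mean_sum[OF m]) (auto intro!: linf_sum Y)
      also have "\<dots> = (\<Sum>i<n. \<Sum>j<n. \<phi> (Y i j))"
        by (intro sum.cong refl mean_sum[OF m] Y) auto
      also have "\<dots> = (\<Sum>i<n. \<Sum>j<n. cnj (v i) * \<Phi> (X i j) k * v j)"
      proof (intro sum.cong refl)
        fix i j assume "i \<in> {..<n}" "j \<in> {..<n}"
        then have "(\<lambda>p. X i j (p + k)) \<in> linf"
          unfolding linf_shift_iff by (intro X) auto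
        then have "\<phi> (Y i j) = cnj (v i) * v j * \<Phi> (X i j) k"
          unfolding Y_def \<Phi>_def orbit_map_def by (rule mean_scale[OF m])
        then show "\<phi> (Y i j) = cnj (v i) * \<Phi> (X i j) k * v j" by (simp add: mult_ac)
      qed
      finally show ?thesis .
    qed
    then show "psd_mat n (\<lambda>i j. \<Phi> (X i j) k)"
      by (simp add: psd_mat_def Let_def complex_nonneg_Reals_iff)
  qed
  moreover have "\<Phi> (bshift x) = bshift (\<Phi> x)" for x
    unfolding \<Phi>_def bshift_def by (rule orbit_map_shift)
  moreover have "cstar_subalgebra (\<Phi> ` linf)"
    unfolding cstar_subalgebra_def
  proof (intro conjI ballI allI impI)
    show "\<Phi> ` linf \<subseteq> linf" using linf by blast
    show "(\<lambda>n. 0) \<in> \<Phi> ` linf"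
      unfolding range by (simp add: \<Phi>_def orbit_map_const[OF m])
    fix x assume x: "x \<in> \<Phi> ` linf"
    then have x': "x \<in> linf" "\<Phi> x = x" by (auto simp: range)
    show "(\<lambda>n. a * x n) \<in> \<Phi> ` linf" for a
      using lin[OF x'(1) x'(1), of a 0] x' by (simp add: range)
    show "(\<lambda>n. cnj (x n)) \<in> \<Phi> ` linf"
    proof -
      have "\<Phi> (\<lambda>n. cnj (x n)) = (\<lambda>n. cnj (\<Phi> x n))"
        unfolding \<Phi>_def orbit_map_def by (intro ext mean_cnj[OF m linf_comp[OF x'(1)]])
      then show ?thesis using x' by (simp add: range)
    qed
    fix y assume "y \<in> \<Phi> ` linf"
    then have y': "y \<in> linf" "\<Phi> y = y" by (auto simp: range)
    show "(\<lambda>n. x n + y n) \<in> \<Phi> ` linf"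
      using lin[OF x'(1) y'(1), of 1 1] x' y' by (simp add: range)
    \<comment> \<open>For fixed points the module property reads
      \<open>\<Phi> (x y) = x y\<close>.\<close>
    show "(\<lambda>n. x n * y n) \<in> \<Phi> ` linf"
      using mult_\<Phi>[OF y'(1) x'(1)] x' y' by (simp add: range)
  next
    fix f :: "nat \<Rightarrow> int \<Rightarrow> complex" and x
    assume x: "x \<in> linf"
      and f: "(\<forall>k. f k \<in> \<Phi> ` linf) \<and> (\<lambda>k. supnorm (\<lambda>n. f k n - x n)) \<longlonglongrightarrow> 0"
    have "\<Phi> x n = x n" for n
    proof -
      define s where "s k = supnorm (\<lambda>n. f k n - x n)" for k
      have fk: "f k \<in> linf" "\<Phi> (f k) = f k" for k using f by (auto simp: range)
      have s: "cmod (f k n - x n) \<le> s k" for k n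
      proof -
        obtain M where "\<And>n. cmod (f k n - x n) \<le> M"
          using linf_diff[OF fk(1) x] unfolding linf_def by blast
        then show ?thesis
          unfolding s_def supnorm_def by (intro cSUP_upper bdd_aboveI2[of _ _ M]) auto
      qed
      \<comment> \<open>\<open>\<Phi>\<close> is a contraction fixing \<open>f k\<close>, so both
        \<open>x\<close> and \<open>\<Phi> x\<close> lie within \<open>s k\<close> of it.\<close>
      have "cmod (\<Phi> x n - x n) \<le> 2 * s k" for k
      proof -
        have "\<Phi> (\<lambda>n. f k n - x n) = (\<lambda>n. f k n - \<Phi> x n)"
          using lin[OF fk(1)[of k] x, of 1 "-1"] fk by simp
        then have "cmod (f k n - \<Phi> x n) \<le> s k"
          using orbit_map_bound[OF m, of "\<lambda>n. f k n - x n" "s k" n] s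
          unfolding \<Phi>_def[symmetric] by simp
        then have "cmod ((f k n - x n) - (f k n - \<Phi> x n)) \<le> s k + s k"
          using s[of k n] by (intro norm_triangle_le_diff) auto
        then show ?thesis by simp
      qed
      moreover have "(\<lambda>k. 2 * s k) \<longlonglongrightarrow> 2 * 0"
        using f unfolding s_def by (intro tendsto_mult_left) simp
      ultimately have "cmod (\<Phi> x n - x n) \<le> 2 * 0"
        by (intro LIMSEQ_le_const[of "\<lambda>k. 2 * s k"]) blast+
      then show ?thesis by simp
    qed
    then show "x \<in> \<Phi> ` linf"
      unfolding range using x by blast
  qed
  moreover have "\<exists>x\<in>linf. \<exists>y\<in>linf. \<Phi> (\<lambda>n. x n * y n) \<noteq> (\<lambda>n. \<Phi> x n * \<Phi> y n)"
  proof -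
    \<comment> \<open>A character outside the spectrum is sent to 0, while its product with its
      conjugate is the constant 1.\<close>
    obtain l where l: "cmod l = 1" "l \<notin> roots_of_unity"
      using roots_of_unity_proper roots_of_unity_sphere by (auto simp: set_eq_iff)
    have "(\<lambda>n. xchar l n * cnj (xchar l n)) = (\<lambda>n. 1)"
      using cmod_xchar[OF l(1)] by (simp flip: complex_norm_square)
    then have "\<Phi> (\<lambda>n. xchar l n * cnj (xchar l n)) = (\<lambda>n. 1)"
      unfolding \<Phi>_def using orbit_map_const[OF m] by simp
    moreover have "\<Phi> (xchar l) = (\<lambda>n. 0)"
      using char[OF l(1)] l(2) by simp
    ultimately have "\<Phi> (\<lambda>n. xchar l n * cnj (xchar l n)) \<noteq> (\<lambda>n. \<Phi> (xchar l) n * \<Phi> (\<lambda>n. cnj (xchar l n)) n)"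
      by (simp add: fun_eq_iff)
    then have "\<exists>y\<in>linf. \<Phi> (\<lambda>n. xchar l n * y n) \<noteq> (\<lambda>n. \<Phi> (xchar l) n * \<Phi> y n)"
      by (rule rev_bexI[OF linf_cnj[OF xchar_linf[OF l(1)]]])
    then show ?thesis
      by (rule rev_bexI[OF xchar_linf[OF l(1)]])
  qed
  moreover have "\<Phi> x = (\<lambda>n. 0)" if "x \<in> c0" for x
    unfolding \<Phi>_def by (rule orbit_map_c0[OF K that])
  moreover have "spec \<Phi> = roots_of_unity"
  proof -
    have "eigcoef \<Phi> l = (if l \<in> roots_of_unity then 1 else 0)" if "cmod l = 1" for l
      unfolding eigcoef_def
    proof (rule the_equality)
      show "\<Phi> (xchar l) = (\<lambda>n. (if l \<in> roots_of_unity then 1 else 0) * xchar l n)"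
        by (rule char[OF that])
      \<comment> \<open>Coordinate 0 of a character is 1, which pins down the scalar.\<close>
      fix c assume "\<Phi> (xchar l) = (\<lambda>n. c * xchar l n)"
      then have "(if l \<in> roots_of_unity then 1 else 0) * xchar l 0 = c * xchar l 0"
        unfolding char[OF that] by (rule fun_cong)
      then show "c = (if l \<in> roots_of_unity then 1 else 0)"
        by (simp add: xchar_def)
    qed
    then show ?thesis
      using roots_of_unity_sphere by (auto simp: spec_def subset_iff split: if_splits)
  qed
  ultimately show ?thesis
    using subgroup_roots_of_unity closure_roots_of_unity roots_of_unity_proper
    by (intro exI[of _ \<Phi>] conjI ballI) (simp_all add: idem_\<Phi>)
qed

end
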